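(* Let $\mu$ and $\tilde{\mu}$ be continuous computable measures on $\mathbb{B}^\omega$. For every universal monotone machine $U$ that is compatible with $\mu$, there is a universal monotone machine $\widetilde{U}$ such that $\mu_U = \tilde{\mu}_{\widetilde{U}}$, i.e. $\mu_U(\sigma)=\tilde{\mu}_{\widetilde{U}}(\sigma)$ for all $\sigma\in\mathbb{B}^*$.
   Context: $\mathbb{B}=\{0,1\}$; $\mathbb{B}^*$ is the set of finite bit strings and $\mathbb{B}^\omega$ the set of infinite bit strings. $\sigma\preccurlyeq\tau$ means $\sigma$ is an initial segment of $\tau$; $\sigma\sim\tau$ means $\sigma\preccurlyeq\tau$ or $\tau\preccurlyeq\sigma$. For $\sigma\in\mathbb{B}^*$, $\llbracket\sigma\rrbracket=\{\sigma X: X\in\mathbb{B}^\omega\}$; for $A\subseteq\mathbb{B}^*$, $\llbracket A\rrbracket=\bigcup_{\sigma\in A}\llbracket\sigma\rrbracket$. A computable measure is a Borel probability measure $\mu$ on $\mathbb{B}^\omega$ such that the reals $\mu(\llbracket\sigma\rrbracket)$ are uniformly computable in $\sigma$: there is a computable $g:\mathbb{B}^*\times\mathbb{N}\to\mathbb{Q}$ with $|g(\sigma,k)-\mu(\llbracket\sigma\rrbracket)|<2^{-k}$ for all $\sigma,k$. It is continuous if $\mu(\{X\})=0$ for every $X\in\mathbb{B}^\omega$. A monotone machine is a c.e. set $M\subseteq\mathbb{B}^*\times\mathbb{B}^*$ such that if $(\rho_1,\sigma_1),(\rho_2,\sigma_2)\in M$ and $\rho_1\preccurlyeq\rho_2$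 then $\sigma_1\sim\sigma_2$. The transformation of a computable measure $\mu$ by a monotone machine $M$ is the function $\mu_M(\sigma):=\mu(\llbracket\{\rho:\exists\sigma'\succcurlyeq\sigma\ ((\rho,\sigma')\in M)\}\rrbracket)$ for $\sigma\in\mathbb{B}^*$. A computable enumeration $\{M_e\}_{e\in\mathbb{N}}$ of all monotone machines is a uniformly c.e. sequence in which exactly the monotone machines occur and which is acceptable: for every uniformly c.e. sequence $\{N_k\}_k$ of monotone machines there is a computable $h:\mathbb{N}\to\mathbb{N}$ with $N_k=M_{h(k)}$ for all $k$. An encoding is a computable sequence $\{\rho_e\}_{e\in\mathbb{N}}$ of pairwise distinct strings in $\mathbb{B}^*$ forming a prefix-free set. A monotone machine $U$ is universal (by adjunction) if for some encoding $\{\rho_e\}_e$ and some computable enumeration $\{M_e\}_e$ of all monotone machines, $(\rho_e\rho,\sigma)\in U\Leftrightarrow(\rho,\sigma)\in M_e$ for all $e,\rho,\sigma$, and every pair in $U$ has a first component of the form $\rho_e\rho$. $U$ is compatible with a measure $\mu$ if such an associated encoding $\{\rho_e\}_e$ can be taken with $\mu(\llbracket\rho_e\rrbracket)>0$ for all $e\in\mathbb{N}$. *)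

theory Defs
  imports
    "HOL-Analysis.Analysis"
    "HOL-Probability.Probability_Measure"
    "HOL-Library.Nat_Bijection"
    "HOL-Library.Sublist"
    "HOL-Library.Omega_Words_Fun"
begin

hide_const (open) Omega_Words_Fun.prefix Omega_Words_Fun.suffix

section \<open>Computability\<close>

text \<open>
  The partial recursive functions of one argument: the least class of partial functions on the
  natural numbers that contains zero, successor and the two projections of the Cantor pairing
  function, and is closed under pairing, composition, primitive recursion (with one parameter)
  and unbounded minimization. Functions of several arguments are represented by packing the
  arguments with \<^const>\<open>prod_encode\<close>.
\<close>

primrec prec_fun :: "(nat \<rightharpoonup> nat) \<Rightarrow> (nat \<rightharpoonup> nat) \<Rightarrow> nat \<Rightarrow> nat \<Rightarrow> nat option" where
  "prec_fun f g a 0 = f a"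
| "prec_fun f g a (Suc k) =
     Option.bind (prec_fun f g a k) (\<lambda>r. g (prod_encode (a, prod_encode (k, r))))"

text \<open>
  The search for the least zero of \<open>k \<mapsto> f (a, k)\<close> diverges if a value \<open>f (a, j)\<close> before the
  first zero is undefined.
\<close>

definition search_fun :: "(nat \<rightharpoonup> nat) \<Rightarrow> nat \<rightharpoonup> nat" where
  "search_fun f a =
     (if \<exists>k. f (prod_encode (a, k)) = Some 0 \<and> (\<forall>j<k. f (prod_encode (a, j)) \<noteq> None)
      then Some (LEAST k. f (prod_encode (a, k)) = Some 0) else None)"

inductive partial_recursive :: "(nat \<rightharpoonup> nat) \<Rightarrow> bool" where
  zero: "partial_recursive (\<lambda>n. Some 0)"
| succ: "partial_recursive (\<lambda>n. Some (Suc n))"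
| left: "partial_recursive (\<lambda>n. Some (fst (prod_decode n)))"
| right: "partial_recursive (\<lambda>n. Some (snd (prod_decode n)))"
| pair: "partial_recursive f \<Longrightarrow> partial_recursive g \<Longrightarrow>
    partial_recursive (\<lambda>n. Option.bind (f n) (\<lambda>a. Option.bind (g n) (\<lambda>b. Some (prod_encode (a, b)))))"
| comp: "partial_recursive f \<Longrightarrow> partial_recursive g \<Longrightarrow>
    partial_recursive (\<lambda>n. Option.bind (g n) f)"
| prec: "partial_recursive f \<Longrightarrow> partial_recursive g \<Longrightarrow>
    partial_recursive (\<lambda>n. prec_fun f g (fst (prod_decode n)) (snd (prod_decode n)))"
| search: "partial_recursive f \<Longrightarrow> partial_recursive (search_fun f)"

definition recursive :: "(nat \<Rightarrow> nat) \<Rightarrow> bool" where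
  "recursive f \<longleftrightarrow> partial_recursive (\<lambda>n. Some (f n))"

definition ce :: "nat set \<Rightarrow> bool" where
  "ce A \<longleftrightarrow> (\<exists>f. partial_recursive f \<and> A = dom f)"


section \<open>Finite and infinite bit strings\<close>

text \<open>
  Finite strings are coded in bijective base-2 notation, least significant digit first, the
  digits being \<open>1\<close> (for \<^const>\<open>False\<close>) and \<open>2\<close> (for \<^const>\<open>True\<close>).
\<close>

primrec str_encode :: "bool list \<Rightarrow> nat" where
  "str_encode [] = 0"
| "str_encode (b # \<sigma>) = 2 * str_encode \<sigma> + (if b then 2 else 1)"

lemma bij_str_encode: "bij str_encode"
proof (rule bijI)
  have "str_encode \<sigma> = str_encode \<tau> \<Longrightarrow> \<sigma> = \<tau>" for \<sigma> \<tau>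
  proof (induction \<sigma> arbitrary: \<tau>)
    case Nil
    then show ?case by (cases \<tau>) (auto split: if_splits)
  next
    case (Cons b \<sigma>)
    then obtain c \<tau>' where \<tau>: "\<tau> = c # \<tau>'" by (cases \<tau>) (auto split: if_splits)
    have eq: "2 * str_encode \<sigma> + (if b then 2 else 1) = 2 * str_encode \<tau>' + (if c then 2 else 1)"
      using Cons.prems \<tau> by simp
    then have "b = c" by (cases b; cases c) (simp_all, presburger+)
    then show ?case using eq Cons.IH \<tau> by auto
  qed
  then show "inj str_encode" by (rule injI)
  have "n \<in> range str_encode" for n
  proof (induction n rule: less_induct)
    case (less n)
    show ?case
    proof (cases "n = 0")
      case True
      then show ?thesis by (metis rangeI str_encode.simps(1))
    next
      case False
      then have "(n - 1) div 2 < n" by linarith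
      then obtain \<sigma> where \<sigma>: "(n - 1) div 2 = str_encode \<sigma>" using less by blast
      have "n = str_encode (even n # \<sigma>)" using False \<sigma>[symmetric] by simp presburger
      then show ?thesis by blast
    qed
  qed
  then show "surj str_encode" by blast
qed

definition comparable :: "bool list \<Rightarrow> bool list \<Rightarrow> bool" (infix \<open>\<sim>\<^sub>s\<close> 50) where
  "\<sigma> \<sim>\<^sub>s \<tau> \<longleftrightarrow> prefix \<sigma> \<tau> \<or> prefix \<tau> \<sigma>"

text \<open>Infinite strings are \<open>\<omega>\<close>-words \<^typ>\<open>nat \<Rightarrow> bool\<close>; \<^const>\<open>conc\<close> prepends a finite string.\<close>

definition cylinder :: "bool list \<Rightarrow> bool word set" where
  "cylinder \<sigma> = range (conc \<sigma>)"

definition cylinders :: "bool list set \<Rightarrow> bool word set" where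
  "cylinders A = (\<Union>\<sigma>\<in>A. cylinder \<sigma>)"


section \<open>Computable measures\<close>

text \<open>
  A function into the rationals is computable if it is the composition of a recursive function
  with the numbering \<^const>\<open>nat_to_rat_surj\<close>, which decodes a numerator and a denominator.
\<close>

definition computable_rat_fun :: "(bool list \<times> nat \<Rightarrow> rat) \<Rightarrow> bool" where
  "computable_rat_fun g \<longleftrightarrow>
     (\<exists>f. recursive f \<and> (\<forall>\<sigma> k. g (\<sigma>, k) = nat_to_rat_surj (f (prod_encode (str_encode \<sigma>, k)))))"

text \<open>The topology on \<^typ>\<open>nat \<Rightarrow> bool\<close> is the product of the discrete topologies.\<close>

definition computable_measure :: "bool word measure \<Rightarrow> bool" where
  "computable_measure \<mu> \<longleftrightarrow> prob_space \<mu> \<and> sets \<mu> = sets borel \<and>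
     (\<exists>g. computable_rat_fun g \<and>
       (\<forall>\<sigma> k. \<bar>real_of_rat (g (\<sigma>, k)) - measure \<mu> (cylinder \<sigma>)\<bar> < 1 / 2 ^ k))"

definition continuous_measure :: "bool word measure \<Rightarrow> bool" where
  "continuous_measure \<mu> \<longleftrightarrow> (\<forall>X. measure \<mu> {X} = 0)"


section \<open>Monotone machines\<close>

type_synonym machine = "(bool list \<times> bool list) set"

definition uniformly_ce :: "(nat \<Rightarrow> machine) \<Rightarrow> bool" where
  "uniformly_ce N \<longleftrightarrow>
     ce {prod_encode (k, prod_encode (str_encode \<rho>, str_encode \<sigma>)) | k \<rho> \<sigma>. (\<rho>, \<sigma>) \<in> N k}"

definition monotone_machine :: "machine \<Rightarrow> bool" where
  "monotone_machine M \<longleftrightarrow>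
     ce {prod_encode (str_encode \<rho>, str_encode \<sigma>) | \<rho> \<sigma>. (\<rho>, \<sigma>) \<in> M} \<and>
     (\<forall>\<rho>\<^sub>1 \<sigma>\<^sub>1 \<rho>\<^sub>2 \<sigma>\<^sub>2. (\<rho>\<^sub>1, \<sigma>\<^sub>1) \<in> M \<longrightarrow> (\<rho>\<^sub>2, \<sigma>\<^sub>2) \<in> M \<longrightarrow> prefix \<rho>\<^sub>1 \<rho>\<^sub>2 \<longrightarrow> \<sigma>\<^sub>1 \<sim>\<^sub>s \<sigma>\<^sub>2)"

definition transformation :: "bool word measure \<Rightarrow> machine \<Rightarrow> bool list \<Rightarrow> real" where
  "transformation \<mu> M \<sigma> = measure \<mu> (cylinders {\<rho>. \<exists>\<sigma>'. prefix \<sigma> \<sigma>' \<and> (\<rho>, \<sigma>') \<in> M})"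

definition machine_enumeration :: "(nat \<Rightarrow> machine) \<Rightarrow> bool" where
  "machine_enumeration M \<longleftrightarrow>
     uniformly_ce M \<and> range M = {N. monotone_machine N} \<and>
     (\<forall>N. uniformly_ce N \<and> (\<forall>k. monotone_machine (N k)) \<longrightarrow>
       (\<exists>h. recursive h \<and> (\<forall>k. N k = M (h k))))"

definition encoding :: "(nat \<Rightarrow> bool list) \<Rightarrow> bool" where
  "encoding \<rho> \<longleftrightarrow> recursive (\<lambda>e. str_encode (\<rho> e)) \<and> inj \<rho> \<and>
     (\<forall>d e. prefix (\<rho> d) (\<rho> e) \<longrightarrow> \<rho> d = \<rho> e)"

definition universal_via :: "(nat \<Rightarrow> bool list) \<Rightarrow> (nat \<Rightarrow> machine) \<Rightarrow> machine \<Rightarrow> bool" where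
  "universal_via code M U \<longleftrightarrow> encoding code \<and> machine_enumeration M \<and>
     (\<forall>e \<rho> \<sigma>. (code e @ \<rho>, \<sigma>) \<in> U \<longleftrightarrow> (\<rho>, \<sigma>) \<in> M e) \<and>
     (\<forall>(\<tau>, \<sigma>)\<in>U. \<exists>e \<rho>. \<tau> = code e @ \<rho>)"

definition universal_machine :: "machine \<Rightarrow> bool" where
  "universal_machine U \<longleftrightarrow> monotone_machine U \<and> (\<exists>code M. universal_via code M U)"

definition compatible :: "machine \<Rightarrow> bool word measure \<Rightarrow> bool" where
  "compatible U \<mu> \<longleftrightarrow>
     (\<exists>code M. universal_via code M U \<and> (\<forall>e. measure \<mu> (cylinder (code e)) > 0))"

end

theory Submission
  imports Defs
begin

text \<open>
  Laying out the cylinders of each length from left to right in lexicographic order, a continuous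
  measure assigns to every string \<open>\<rho>\<close> a subinterval of \<open>[0, 1]\<close> of length \<open>\<mu>(\<lbrakk>\<rho>\<rbrakk>)\<close>. A machine for
  \<open>\<mu>\<close> is transported to one for \<open>\<nu>\<close> by giving to \<open>\<tau>\<close> every output of a string \<open>\<rho>\<close> whose
  \<open>\<mu>\<close>-interval contains the \<open>\<nu>\<close>-interval of \<open>\<tau>\<close> in its interior; this preserves monotonicity,
  enumerability and the transformation.

  The transport of a universal machine \<open>U\<close> need not be universal by adjunction. To repair this, let
  \<open>\<kappa>\<^sub>e\<close> be a string whose \<open>\<mu>'\<close>-interval lies inside the \<open>\<mu>\<close>-interval of the code \<open>\<rho>\<^sub>e\<close>. By
  the recursion theorem some machine \<open>M\<^sub>c\<close> is, behind its code \<open>\<rho>\<^sub>c\<close>, the transport from \<open>\<mu>'\<close> back to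
  \<open>\<mu>\<close> of the machine that runs a copy of every \<open>M\<^sub>k\<close> behind \<open>\<kappa>\<^sub>c1\<^sup>k0\<close>. Transporting from \<open>\<mu>\<close> to
  \<open>\<mu>'\<close> all of \<open>U\<close> except the part behind \<open>\<rho>\<^sub>c\<close> and placing these copies behind \<open>\<kappa>\<^sub>c\<close> instead gives
  a machine with the same transformation. It is universal, since the finitely many siblings of the
  prefixes of \<open>\<kappa>\<^sub>c\<close> serve as codes for its transported part.
\<close>

section \<open>Recursive functions and semidecidable predicates\<close>

abbreviation p1 :: "nat \<Rightarrow> nat" where "p1 n \<equiv> fst (prod_decode n)"

abbreviation p2 :: "nat \<Rightarrow> nat" where "p2 n \<equiv> snd (prod_decode n)"

named_theorems recs

lemma recursive_comp: "recursive f \<Longrightarrow> recursive g \<Longrightarrow> recursive (\<lambda>n. f (g n))"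
  unfolding recursive_def by (drule (1) partial_recursive.comp) simp

lemma recursive_p1 [recs]: "recursive f \<Longrightarrow> recursive (\<lambda>n. p1 (f n))"
  by (rule recursive_comp[of p1]) (simp_all add: recursive_def partial_recursive.left)

lemma recursive_p2 [recs]: "recursive f \<Longrightarrow> recursive (\<lambda>n. p2 (f n))"
  by (rule recursive_comp[of p2]) (simp_all add: recursive_def partial_recursive.right)

lemma recursive_Suc [recs]: "recursive f \<Longrightarrow> recursive (\<lambda>n. Suc (f n))"
  by (rule recursive_comp[of Suc]) (simp_all add: recursive_def partial_recursive.succ)

lemma recursive_pair [recs]:
  "recursive f \<Longrightarrow> recursive g \<Longrightarrow> recursive (\<lambda>n. prod_encode (f n, g n))"
  unfolding recursive_def by (drule (1) partial_recursive.pair) simp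

lemma recursive_id [recs]: "recursive (\<lambda>n. n)"
proof -
  have "recursive p1" "recursive p2"
    by (simp_all add: recursive_def partial_recursive.left partial_recursive.right)
  from recursive_pair[OF this] show ?thesis by simp
qed

lemma recursive_const [recs]: "recursive (\<lambda>n. c)"
proof (induction c)
  case 0
  then show ?case by (simp add: recursive_def partial_recursive.zero)
qed (rule recursive_Suc)

text \<open>Total functions never meet the undefined case of \<open>prec_fun\<close>, which then
  agrees with \<open>rec_nat\<close>. The step may use the argument, the round and the previous
  value, so the bounded loops below are instances.\<close>

lemma recursive_rec_nat [recs]:
  assumes "recursive f" "recursive (\<lambda>x. g (p1 x) (p1 (p2 x)) (p2 (p2 x)))" "recursive m"
  shows "recursive (\<lambda>n. rec_nat (f n) (g n) (m n))"
proof -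
  let ?h = "\<lambda>x. rec_nat (f (p1 x)) (g (p1 x)) (p2 x)"
  have "prec_fun (\<lambda>n. Some (f n)) (\<lambda>x. Some (g (p1 x) (p1 (p2 x)) (p2 (p2 x)))) a k
      = Some (rec_nat (f a) (g a) k)" for a k
    by (induction k) auto
  then have "recursive ?h"
    using partial_recursive.prec[OF assms(1,2)[unfolded recursive_def]] by (simp add: recursive_def)
  from recursive_comp[OF this recursive_pair[OF recursive_id assms(3)]] show ?thesis by simp
qed

lemma recursive_add [recs]:
  assumes "recursive f" "recursive g" shows "recursive (\<lambda>n. f n + g n)"
proof -
  have "rec_nat a (\<lambda>_ r. Suc r) b = a + b" for a b by (induction b) auto
  then show ?thesis
    using recursive_rec_nat[OF assms(1) _ assms(2), of "\<lambda>_ _ r. Suc r"] by (simp add: recs)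
qed

lemma recursive_mult [recs]:
  assumes "recursive f" "recursive g" shows "recursive (\<lambda>n. f n * g n)"
proof -
  have "rec_nat 0 (\<lambda>_ r. r + a) b = a * b" for a b :: nat by (induction b) auto
  then show ?thesis
    using recursive_rec_nat[OF recursive_const[of 0] _ assms(2), of "\<lambda>n _ r. r + f n"] assms
    by (simp add: recs recursive_comp[of f])
qed

lemma recursive_diff [recs]:
  assumes "recursive f" "recursive g" shows "recursive (\<lambda>n. f n - g n)"
proof -
  have "rec_nat 0 (\<lambda>k _. k) b = b - 1" for b :: nat by (cases b) auto
  then have pred: "recursive (\<lambda>n. n - 1)"
    using recursive_rec_nat[OF recursive_const[of 0] _ recursive_id, of "\<lambda>_ k _. k"]
    by (simp add: recs)
  have "rec_nat a (\<lambda>_ r. r - 1) b = a - b" for a b :: nat by (induction b) auto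
  then show ?thesis
    using recursive_rec_nat[OF assms(1) _ assms(2), of "\<lambda>n _ r. r - 1"] assms
    by (simp add: recs recursive_comp[OF pred] del: One_nat_def)
qed

lemma recursive_power [recs]:
  assumes "recursive f" "recursive g" shows "recursive (\<lambda>n. f n ^ g n)"
proof -
  have "rec_nat 1 (\<lambda>_ r. r * a) b = a ^ b" for a b :: nat by (induction b) auto
  then show ?thesis
    using recursive_rec_nat[OF recursive_const[of 1] _ assms(2), of "\<lambda>n _ r. r * f n"] assms
    by (simp add: recs recursive_comp[of f])
qed

section \<open>Decidable predicates, division and bounded loops\<close>

definition decidable :: "(nat \<Rightarrow> bool) \<Rightarrow> bool" where
  "decidable P \<longleftrightarrow> recursive (\<lambda>n. of_bool (P n))"

lemma decidable_comp: "decidable P \<Longrightarrow> recursive f \<Longrightarrow> decidable (\<lambda>n. P (f n))"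
  unfolding decidable_def by (rule recursive_comp)

lemma decidable_not [recs]: "decidable P \<Longrightarrow> decidable (\<lambda>n. \<not> P n)"
proof -
  assume "decidable P"
  then have "recursive (\<lambda>n. 1 - of_bool (P n))" by (simp add: decidable_def recs del: One_nat_def)
  moreover have "1 - of_bool (P n) = (of_bool (\<not> P n) :: nat)" for n by simp
  ultimately show ?thesis by (simp add: decidable_def del: One_nat_def of_bool_not_iff)
qed

lemma decidable_conj [recs]: "decidable P \<Longrightarrow> decidable Q \<Longrightarrow> decidable (\<lambda>n. P n \<and> Q n)"
  by (simp add: decidable_def of_bool_conj recs)

lemma decidable_disj [recs]: "decidable P \<Longrightarrow> decidable Q \<Longrightarrow> decidable (\<lambda>n. P n \<or> Q n)"
  using decidable_not[OF decidable_conj[OF decidable_not decidable_not, of P Q]] by simp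

lemma decidable_le [recs]:
  assumes "recursive f" "recursive g" shows "decidable (\<lambda>n. f n \<le> g n)"
proof -
  have "1 - (f n - g n) = of_bool (f n \<le> g n)" for n by simp
  then show ?thesis
    using recursive_diff[OF recursive_const[of 1] recursive_diff[OF assms]]
    by (simp add: decidable_def del: One_nat_def)
qed

lemma decidable_less [recs]: "recursive f \<Longrightarrow> recursive g \<Longrightarrow> decidable (\<lambda>n. f n < g n)"
  using decidable_not[OF decidable_le, of g f] by (simp add: not_le)

lemma decidable_eq [recs]: "recursive f \<Longrightarrow> recursive g \<Longrightarrow> decidable (\<lambda>n. f n = g n)"
  using decidable_conj[OF decidable_le decidable_le, of f g g f] by (simp add: eq_iff[symmetric])

lemma recursive_if [recs]:
  assumes "decidable P" "recursive f" "recursive g"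
  shows "recursive (\<lambda>n. if P n then f n else g n)"
proof -
  have "(if P n then f n else g n) = of_bool (P n) * f n + of_bool (\<not> P n) * g n" for n by simp
  then show ?thesis
    using assms decidable_not[OF assms(1)]
    by (simp add: decidable_def recs del: of_bool_not_iff)
qed

lemma recursive_div [recs]:
  assumes "recursive f" "recursive g" shows "recursive (\<lambda>n. f n div g n)"
proof -
  \<comment> \<open>The quotient is counted upwards along the dividend: passing from
    \<open>k\<close> to \<open>Suc k\<close> raises it by one exactly when the next multiple of
    \<open>b\<close> fits. The guard \<open>b \<noteq> 0\<close> yields the HOL value 0 for division
    by zero.\<close>
  let ?h = "\<lambda>b k r. if b \<noteq> 0 \<and> Suc r * b \<le> Suc k then Suc r else r"
  have "rec_nat 0 (?h b) a = a div b" for a b :: nat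
  proof (induction a)
    case (Suc a)
    have "Suc (a div b) * b \<le> Suc a \<longleftrightarrow> Suc (a div b) = Suc a div b" if "b \<noteq> 0"
    proof -
      have "Suc (a div b) * b \<le> Suc a \<longleftrightarrow> Suc (a div b) \<le> Suc a div b"
        using that by (simp add: less_eq_div_iff_mult_less_eq)
      also have "\<dots> \<longleftrightarrow> Suc (a div b) = Suc a div b"
        by (auto simp: div_Suc)
      finally show ?thesis .
    qed
    moreover have "Suc a div b = Suc (a div b) \<or> Suc a div b = a div b"
      by (simp add: div_Suc)
    ultimately show ?case using Suc by (cases "b = 0") (auto simp del: mult_Suc)
  qed simp
  then show ?thesis
    using recursive_rec_nat[OF recursive_const[of 0] _ assms(1), of "\<lambda>n. ?h (g n)"] assms
    by (simp add: recs recursive_comp[of g])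
qed

lemma recursive_mod [recs]:
  "recursive f \<Longrightarrow> recursive g \<Longrightarrow> recursive (\<lambda>n. f n mod g n)"
  using recursive_diff[OF _ recursive_mult[OF recursive_div], of f f g g]
  by (simp add: minus_div_mult_eq_mod)

lemma recursive_sum [recs]:
  assumes "recursive m" "recursive (\<lambda>x. f (p1 x) (p2 x))"
  shows "recursive (\<lambda>n. \<Sum>i<m n. f n i)"
proof -
  have "rec_nat 0 (\<lambda>i r. r + f n i) k = (\<Sum>i<k. f n i)" for n k
    by (induction k) auto
  then show ?thesis
    using recursive_rec_nat[OF recursive_const[of 0] _ assms(1), of "\<lambda>n i r. r + f n i"]
      recursive_comp[OF assms(2), of "\<lambda>x. prod_encode (p1 x, p1 (p2 x))"]
    by (simp add: recs)
qed

text \<open>The iteration stops at the first \<open>k\<close> with \<open>P n k\<close>, or else after \<open>m n\<close> steps.\<close>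

lemma recursive_bounded_search [recs]:
  assumes "recursive m" "decidable (\<lambda>x. P (p1 x) (p2 x))"
  shows "recursive (\<lambda>n. rec_nat 0 (\<lambda>_ k. if P n k then k else Suc k) (m n))"
proof -
  have "decidable (\<lambda>x. P (p1 x) (p2 (p2 x)))"
    using decidable_comp[OF assms(2), of "\<lambda>x. prod_encode (p1 x, p2 (p2 x))"] by (simp add: recs)
  then show ?thesis using assms by (simp add: recs)
qed

lemma bounded_search_less:
  "j < rec_nat 0 (\<lambda>_ k. if P k then k else Suc k) m \<Longrightarrow> \<not> P j"
  by (induction m) (auto split: if_splits simp: less_Suc_eq)

lemma bounded_search_eq:
  assumes "P k" "\<And>j. j < k \<Longrightarrow> \<not> P j" "k \<le> m"
  shows "rec_nat 0 (\<lambda>_ k. if P k then k else Suc k) m = k"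
proof -
  \<comment> \<open>Before the first hit the counter equals the number of rounds; from then on it
    stays at \<open>k\<close>.\<close>
  have "rec_nat 0 (\<lambda>_ k. if P k then k else Suc k) m = min m k"
  proof (induction m)
    case (Suc m)
    then show ?case using assms(1) assms(2)[of m] by (cases m k rule: linorder_cases) auto
  qed simp
  then show ?thesis using assms(3) by simp
qed

section \<open>Unbounded search and simulation in stages\<close>

lemma partial_recursive_Least:
  assumes "decidable (\<lambda>x. P (p1 x) (p2 x))"
  shows "partial_recursive (\<lambda>n. if \<exists>k. P n k then Some (LEAST k. P n k) else None)"
proof -
  have "partial_recursive (search_fun (\<lambda>x. Some (of_bool (\<not> P (p1 x) (p2 x)))))"
    using decidable_not[OF assms]
    by (intro partial_recursive.search) (simp only: decidable_def recursive_def)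
  then show ?thesis by (rule back_subst[of partial_recursive]) (auto simp: search_fun_def)
qed

text \<open>Replaces the \<open>LEAST\<close> by a condition on finitely many values, which a
  simulation in stages can check.\<close>

lemma search_fun_eq_Some:
  "search_fun f a = Some k \<longleftrightarrow>
     f (prod_encode (a, k)) = Some 0 \<and> (\<forall>j<k. \<exists>b. f (prod_encode (a, j)) = Some (Suc b))"
  (is "?L \<longleftrightarrow> ?R")
proof
  let ?P = "\<lambda>k. f (prod_encode (a, k)) = Some 0"
  assume ?L
  then obtain k' where k': "?P k'" "\<forall>j<k'. f (prod_encode (a, j)) \<noteq> None" and k: "k = (LEAST k. ?P k)"
    by (auto simp: search_fun_def split: if_splits)
  have "?P k" unfolding k by (rule LeastI, rule k')
  moreover have "\<exists>b. f (prod_encode (a, j)) = Some (Suc b)" if "j < k" for j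
  proof -
    have "\<not> ?P j" using that unfolding k by (rule not_less_Least)
    moreover have "j < k'" using that Least_le[of ?P, OF k'(1)] k by simp
    ultimately show ?thesis using k'(2) by (metis not0_implies_Suc not_None_eq)
  qed
  ultimately show ?R by blast
next
  let ?P = "\<lambda>k. f (prod_encode (a, k)) = Some 0"
  assume R: ?R
  then have "(LEAST k. ?P k) = k"
    by (intro Least_equality) (auto, metis nat.simps(3) not_le option.inject)
  moreover have "\<forall>j<k. f (prod_encode (a, j)) \<noteq> None" using R by auto
  ultimately show ?L using R by (auto simp: search_fun_def)
qed

text \<open>A stage \<open>t a s\<close> is \<open>0\<close> while the computation is running and \<open>Suc b\<close> once it has returned \<open>b\<close>.\<close>

definition staged :: "(nat \<rightharpoonup> nat) \<Rightarrow> (nat \<Rightarrow> nat \<Rightarrow> nat) \<Rightarrow> bool" where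
  "staged f t \<longleftrightarrow> recursive (\<lambda>x. t (p1 x) (p2 x)) \<and>
     (\<forall>a s b. t a s = Suc b \<longrightarrow> f a = Some b) \<and>
     (\<forall>a b. f a = Some b \<longrightarrow> (\<forall>\<^sub>F s in sequentially. t a s = Suc b))"

lemma stagedI:
  assumes "recursive (\<lambda>x. t (p1 x) (p2 x))"
    and "\<And>a s b. t a s = Suc b \<Longrightarrow> f a = Some b"
    and "\<And>a b. f a = Some b \<Longrightarrow> \<forall>\<^sub>F s in sequentially. t a s = Suc b"
  shows "staged f t"
  using assms by (auto simp: staged_def)

lemma stagedD:
  assumes "staged f t"
  shows "t a s = Suc b \<Longrightarrow> f a = Some b"
    and "f a = Some b \<Longrightarrow> \<forall>\<^sub>F s in sequentially. t a s = Suc b"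
  using assms by (auto simp: staged_def)

lemma recursive_staged:
  "staged f t \<Longrightarrow> recursive g \<Longrightarrow> recursive h \<Longrightarrow> recursive (\<lambda>n. t (g n) (h n))"
  using recursive_comp[of "\<lambda>x. t (p1 x) (p2 x)" "\<lambda>n. prod_encode (g n, h n)"]
  by (simp add: staged_def recs)

lemma staged_total: "recursive f \<Longrightarrow> staged (\<lambda>n. Some (f n)) (\<lambda>a _. Suc (f a))"
  by (rule stagedI) (auto simp: recs recursive_comp[of f])

lemma staged_pair:
  assumes f: "staged f t" and g: "staged g u"
  shows "staged (\<lambda>n. Option.bind (f n) (\<lambda>a. Option.bind (g n) (\<lambda>b. Some (prod_encode (a, b)))))
    (\<lambda>a s. if t a s = 0 \<or> u a s = 0 then 0 else Suc (prod_encode (t a s - 1, u a s - 1)))"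
    (is "staged ?h ?v")
proof (rule stagedI)
  show "recursive (\<lambda>x. ?v (p1 x) (p2 x))"
    by (intro recs recursive_staged[OF f] recursive_staged[OF g])
  show "?h a = Some b" if "?v a s = Suc b" for a s b
    using that stagedD(1)[OF f, of a s "t a s - 1"] stagedD(1)[OF g, of a s "u a s - 1"]
    by (auto split: if_splits)
  show "\<forall>\<^sub>F s in sequentially. ?v a s = Suc b" if h: "?h a = Some b" for a b
  proof -
    obtain c d where "f a = Some c" "g a = Some d" "b = prod_encode (c, d)"
      using h by (auto simp: bind_eq_Some_conv)
    with stagedD(2)[OF f, of a c] stagedD(2)[OF g, of a d]
    have "\<forall>\<^sub>F s in sequentially. t a s = Suc c" "\<forall>\<^sub>F s in sequentially. u a s = Suc d" by auto
    then show ?thesis by eventually_elim (simp add: \<open>b = _\<close>)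
  qed
qed

lemma staged_comp:
  assumes f: "staged f t" and g: "staged g u"
  shows "staged (\<lambda>n. Option.bind (g n) f) (\<lambda>a s. if u a s = 0 then 0 else t (u a s - 1) s)"
    (is "staged ?h ?v")
proof (rule stagedI)
  show "recursive (\<lambda>x. ?v (p1 x) (p2 x))"
    by (intro recs recursive_staged[OF f] recursive_staged[OF g])
  show "?h a = Some b" if "?v a s = Suc b" for a s b
    using that stagedD(1)[OF f, of "u a s - 1" s] stagedD(1)[OF g, of a s "u a s - 1"]
    by (auto split: if_splits)
  show "\<forall>\<^sub>F s in sequentially. ?v a s = Suc b" if h: "?h a = Some b" for a b
  proof -
    obtain c where "g a = Some c" "f c = Some b"
      using h by (auto simp: bind_eq_Some_conv)
    with stagedD(2)[OF f, of c b] stagedD(2)[OF g, of a c]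
    have "\<forall>\<^sub>F s in sequentially. t c s = Suc b" "\<forall>\<^sub>F s in sequentially. u a s = Suc c" by auto
    then show ?thesis by eventually_elim simp
  qed
qed

text \<open>All rounds run at the same stage \<open>s\<close>, and an unfinished round passes 0 on
  to the end. Since two eventual properties eventually hold together, induction on the number of
  rounds gives convergence.\<close>

lemma staged_prec:
  assumes f: "staged f t" and g: "staged g u"
  shows "staged (\<lambda>n. prec_fun f g (p1 n) (p2 n))
    (\<lambda>a s. rec_nat (t (p1 a) s)
       (\<lambda>k r. if r = 0 then 0 else u (prod_encode (p1 a, prod_encode (k, r - 1))) s) (p2 a))"
proof -
  let ?v = "\<lambda>a k s. rec_nat (t a s)
    (\<lambda>k r. if r = 0 then 0 else u (prod_encode (a, prod_encode (k, r - 1))) s) k"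
  have "?v a k s = Suc b \<Longrightarrow> prec_fun f g a k = Some b" for a k s b
  proof (induction k arbitrary: b)
    case 0
    then show ?case using stagedD(1)[OF f] by simp
  next
    case (Suc k)
    then obtain r where r: "?v a k s = Suc r" by (cases "?v a k s") auto
    with Suc.prems have "u (prod_encode (a, prod_encode (k, r))) s = Suc b" by simp
    then show ?case using Suc.IH[OF r] stagedD(1)[OF g] by simp
  qed
  moreover have "prec_fun f g a k = Some b \<Longrightarrow> \<forall>\<^sub>F s in sequentially. ?v a k s = Suc b" for a k b
  proof (induction k arbitrary: b)
    case 0
    then show ?case using stagedD(2)[OF f] by simp
  next
    case (Suc k)
    then obtain r where r: "prec_fun f g a k = Some r" "g (prod_encode (a, prod_encode (k, r))) = Some b"
      by (auto simp: bind_eq_Some_conv)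
    from Suc.IH[OF r(1)] stagedD(2)[OF g r(2)] show ?case
      by eventually_elim simp
  qed
  ultimately show ?thesis
    by (intro stagedI recs recursive_staged[OF f] recursive_staged[OF g])
qed

text \<open>The bounded search stops at the first \<open>k\<close> whose value is still unknown
  (stage value 0) or is known to be 0 (stage value 1), and only the second case is accepted.
  Stopping at unknown values ensures that no divergent computation is skipped.\<close>

lemma staged_search:
  assumes f: "staged f t"
  shows "staged (search_fun f)
    (\<lambda>a s. let k = rec_nat 0 (\<lambda>_ k. if t (prod_encode (a, k)) s \<le> 1 then k else Suc k) s
       in if t (prod_encode (a, k)) s = 1 then Suc k else 0)"
proof -
  define m where "m a s = rec_nat 0 (\<lambda>_ k. if t (prod_encode (a, k)) s \<le> 1 then k else Suc k) s" for a s
  have rec_m: "recursive (\<lambda>x. m (p1 x) (p2 x))"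
    unfolding m_def by (intro recs recursive_staged[OF f])
  have "search_fun f a = Some k"
    if "(if t (prod_encode (a, m a s)) s = 1 then Suc (m a s) else 0) = Suc k" for a s k
  proof -
    have k: "m a s = k" "t (prod_encode (a, k)) s = Suc 0"
      using that by (auto split: if_splits)
    have "\<exists>b. f (prod_encode (a, j)) = Some (Suc b)" if "j < k" for j
    proof -
      have "\<not> t (prod_encode (a, j)) s \<le> 1"
        using bounded_search_less[of j "\<lambda>k. t (prod_encode (a, k)) s \<le> 1" s] that k(1)
        by (simp add: m_def)
      then obtain b where "t (prod_encode (a, j)) s = Suc (Suc b)"
        by (metis One_nat_def not_less_eq_eq not0_implies_Suc bot_nat_0.extremum)
      then show ?thesis using stagedD(1)[OF f] by blast
    qed
    then show ?thesis using stagedD(1)[OF f k(2)] by (simp add: search_fun_eq_Some)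
  qed
  moreover have "\<forall>\<^sub>F s in sequentially.
      (if t (prod_encode (a, m a s)) s = 1 then Suc (m a s) else 0) = Suc k"
    if "search_fun f a = Some k" for a k
  proof -
    have k: "f (prod_encode (a, k)) = Some 0" "\<And>j. j < k \<Longrightarrow> \<exists>b. f (prod_encode (a, j)) = Some (Suc b)"
      using that by (auto simp: search_fun_eq_Some)
    \<comment> \<open>Only finitely many computations must finish below the hit, and a stage
      \<open>s \<ge> k\<close> lets the bounded search reach \<open>k\<close>.\<close>
    have "\<forall>\<^sub>F s in sequentially. \<forall>j\<in>{..<k}. t (prod_encode (a, j)) s > 1"
    proof (intro eventually_ball_finite ballI)
      fix j assume "j \<in> {..<k}"
      then obtain b where "f (prod_encode (a, j)) = Some (Suc b)" using k(2) by blast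
      from stagedD(2)[OF f this] show "\<forall>\<^sub>F s in sequentially. t (prod_encode (a, j)) s > 1"
        by eventually_elim simp
    qed simp
    with stagedD(2)[OF f k(1)] eventually_ge_at_top[of k] show ?thesis
    proof eventually_elim
      case (elim s)
      then have "m a s = k"
        unfolding m_def by (intro bounded_search_eq) (auto simp: not_le)
      then show ?case using elim by simp
    qed
  qed
  ultimately show ?thesis
    unfolding Let_def m_def[symmetric]
    by (intro stagedI recs recursive_staged[OF f] rec_m)
qed

text \<open>This plays the part of a normal form theorem: it turns domains of partial recursive
  functions into projections of decidable relations.\<close>

lemma staged_exists: "partial_recursive f \<Longrightarrow> \<exists>t. staged f t"
proof (induction rule: partial_recursive.induct)
  case zero
  show ?case using staged_total[OF recursive_const] by blast
next
  case succ
  show ?case using staged_total[OF recursive_Suc[OF recursive_id]] by blast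
next
  case left
  show ?case using staged_total[OF recursive_p1[OF recursive_id]] by blast
next
  case right
  show ?case using staged_total[OF recursive_p2[OF recursive_id]] by blast
qed (blast intro: staged_pair staged_comp staged_prec staged_search)+

section \<open>Semidecidable predicates as projections of decidable relations\<close>

definition semidecidable :: "(nat \<Rightarrow> bool) \<Rightarrow> bool" where
  "semidecidable P \<longleftrightarrow> ce {n. P n}"

lemma semidecidableI:
  assumes "decidable (\<lambda>x. R (p1 x) (p2 x))" "\<And>n. P n \<longleftrightarrow> (\<exists>s. R n s)"
  shows "semidecidable P"
  unfolding semidecidable_def ce_def
  using partial_recursive_Least[OF assms(1)] by (intro exI conjI) (auto simp: assms(2) dom_def split: if_splits)

lemma semidecidableD:
  assumes "semidecidable P"
  shows "\<exists>R. decidable (\<lambda>x. R (p1 x) (p2 x)) \<and> (\<forall>n. P n \<longleftrightarrow> (\<exists>s. R n s))"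
proof -
  obtain f where f: "partial_recursive f" "{n. P n} = dom f"
    using assms by (auto simp: semidecidable_def ce_def)
  obtain t where t: "staged f t" using staged_exists[OF f(1)] by blast
  have "P n \<longleftrightarrow> (\<exists>s. t n s \<noteq> 0)" for n
  proof
    assume "P n"
    then obtain b where "f n = Some b" using f(2) by blast
    from eventually_happens'[OF sequentially_bot stagedD(2)[OF t this]] show "\<exists>s. t n s \<noteq> 0" by (metis nat.distinct(2))
  next
    assume "\<exists>s. t n s \<noteq> 0"
    then obtain s b where "t n s = Suc b" using not0_implies_Suc by blast
    from stagedD(1)[OF t this] show "P n" using f(2) by blast
  qed
  moreover have "decidable (\<lambda>x. t (p1 x) (p2 x) \<noteq> 0)"
    by (intro recs recursive_staged[OF t])
  ultimately show ?thesis by (intro exI[of _ "\<lambda>n s. t n s \<noteq> 0"]) blast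
qed

lemma decidable_imp_semidecidable: "decidable P \<Longrightarrow> semidecidable P"
  by (rule semidecidableI[of "\<lambda>n _. P n", OF decidable_comp[of P p1]])
    (simp_all add: recs recursive_p1[OF recursive_id])

lemma semidecidable_comp:
  assumes "semidecidable P" "recursive f" shows "semidecidable (\<lambda>n. P (f n))"
proof -
  obtain R where R: "decidable (\<lambda>x. R (p1 x) (p2 x))" "\<And>n. P n \<longleftrightarrow> (\<exists>s. R n s)"
    using semidecidableD[OF assms(1)] by blast
  have "decidable (\<lambda>x. R (f (p1 x)) (p2 x))"
    using decidable_comp[OF R(1), of "\<lambda>x. prod_encode (f (p1 x), p2 x)"] recursive_comp[OF assms(2)]
    by (simp add: recs)
  then show ?thesis by (rule semidecidableI) (simp add: R(2))
qed

lemma semidecidable_ex [recs]: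
  assumes "semidecidable (\<lambda>x. P (p1 x) (p2 x))" shows "semidecidable (\<lambda>n. \<exists>m. P n m)"
proof -
  obtain R where R: "decidable (\<lambda>x. R (p1 x) (p2 x))" "\<And>x. P (p1 x) (p2 x) \<longleftrightarrow> (\<exists>s. R x s)"
    using semidecidableD[OF assms] by blast
  have "decidable (\<lambda>x. R (prod_encode (p1 x, p1 (p2 x))) (p2 (p2 x)))"
    using decidable_comp[OF R(1), of "\<lambda>x. prod_encode (prod_encode (p1 x, p1 (p2 x)), p2 (p2 x))"]
    by (simp add: recs)
  then show ?thesis
  proof (rule semidecidableI[where R = "\<lambda>n w. R (prod_encode (n, p1 w)) (p2 w)"])
    show "(\<exists>m. P n m) \<longleftrightarrow> (\<exists>w. R (prod_encode (n, p1 w)) (p2 w))" for n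
      using R(2)[of "prod_encode (n, m)" for m] by (simp, metis fst_conv snd_conv prod_encode_inverse)
  qed
qed

lemma semidecidable_conj [recs]:
  assumes "semidecidable P" "semidecidable Q" shows "semidecidable (\<lambda>n. P n \<and> Q n)"
proof -
  obtain R where R: "decidable (\<lambda>x. R (p1 x) (p2 x))" "\<And>n. P n \<longleftrightarrow> (\<exists>s. R n s)"
    using semidecidableD[OF assms(1)] by blast
  obtain S where S: "decidable (\<lambda>x. S (p1 x) (p2 x))" "\<And>n. Q n \<longleftrightarrow> (\<exists>s. S n s)"
    using semidecidableD[OF assms(2)] by blast
  have "decidable (\<lambda>x. R (p1 x) (p1 (p2 x)) \<and> S (p1 x) (p2 (p2 x)))"
    using decidable_comp[OF R(1), of "\<lambda>x. prod_encode (p1 x, p1 (p2 x))"]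
      decidable_comp[OF S(1), of "\<lambda>x. prod_encode (p1 x, p2 (p2 x))"]
    by (simp add: recs)
  then show ?thesis
  proof (rule semidecidableI[where R = "\<lambda>n w. R n (p1 w) \<and> S n (p2 w)"])
    show "P n \<and> Q n \<longleftrightarrow> (\<exists>w. R n (p1 w) \<and> S n (p2 w))" for n
      by (simp add: R(2) S(2), metis fst_conv snd_conv prod_encode_inverse)
  qed
qed

lemma semidecidable_disj [recs]:
  assumes "semidecidable P" "semidecidable Q" shows "semidecidable (\<lambda>n. P n \<or> Q n)"
proof -
  obtain R where R: "decidable (\<lambda>x. R (p1 x) (p2 x))" "\<And>n. P n \<longleftrightarrow> (\<exists>s. R n s)"
    using semidecidableD[OF assms(1)] by blast
  obtain S where S: "decidable (\<lambda>x. S (p1 x) (p2 x))" "\<And>n. Q n \<longleftrightarrow> (\<exists>s. S n s)"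
    using semidecidableD[OF assms(2)] by blast
  show ?thesis
    by (rule semidecidableI[OF decidable_disj[OF R(1) S(1)]]) (auto simp: R(2) S(2))
qed

text \<open>The search runs over pairs of a witness and a stage confirming it; the first pair found
  yields the chosen witness.\<close>

lemma recursive_choice:
  assumes "semidecidable (\<lambda>x. P (p1 x) (p2 x))" "\<And>n. \<exists>m. P n m"
  obtains f where "recursive f" "\<And>n. P n (f n)"
proof -
  obtain R where R: "decidable (\<lambda>x. R (p1 x) (p2 x))" "\<And>x. P (p1 x) (p2 x) \<longleftrightarrow> (\<exists>s. R x s)"
    using semidecidableD[OF assms(1)] by blast
  let ?Q = "\<lambda>n w. R (prod_encode (n, p1 w)) (p2 w)"
  have ex: "\<exists>w. ?Q n w" for n
  proof -
    obtain m where "P n m" using assms(2) by blast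
    then obtain s where "R (prod_encode (n, m)) s" using R(2)[of "prod_encode (n, m)"] by auto
    then show ?thesis by (intro exI[of _ "prod_encode (m, s)"]) simp
  qed
  have "decidable (\<lambda>x. ?Q (p1 x) (p2 x))"
    using decidable_comp[OF R(1), of "\<lambda>x. prod_encode (prod_encode (p1 x, p1 (p2 x)), p2 (p2 x))"]
    by (simp add: recs)
  from partial_recursive_Least[OF this] have "recursive (\<lambda>n. LEAST w. ?Q n w)"
    by (simp add: recursive_def ex)
  from recursive_p1[OF this] show ?thesis
  proof (rule that)
    show "P n (p1 (LEAST w. ?Q n w))" for n
      using LeastI_ex[OF ex[of n]] R(2)[of "prod_encode (n, p1 (LEAST w. ?Q n w))"] by auto
  qed
qed

lemma decidable_const [recs]: "decidable (\<lambda>n. c)"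
  by (simp add: decidable_def recursive_const)

text \<open>The bound is fixed and the disjunction is built up one member at a time; this
  accommodates a finite list of machines given without uniformity among them.\<close>

lemma semidecidable_bounded_ex:
  "(\<And>i. i < m \<Longrightarrow> semidecidable (P i)) \<Longrightarrow> semidecidable (\<lambda>n. \<exists>i<m. P i n)" for m :: nat
proof (induction m)
  case 0
  show ?case using decidable_imp_semidecidable[OF decidable_const[of False]] by simp
next
  case (Suc m)
  then have "semidecidable (\<lambda>n. P m n \<or> (\<exists>i<m. P i n))"
    by (intro semidecidable_disj) auto
  then show ?case by (simp add: less_Suc_eq ex_disj_distrib conj_disj_distribR disj_commute)
qed

text \<open>A finite table of values is entered one at a time, each by a case distinction against a
  constant.\<close>

lemma recursive_finite_modification:
  "recursive f \<Longrightarrow> recursive (\<lambda>n. if n < m then g n else f n)"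
proof (induction m)
  case (Suc m)
  then have "recursive (\<lambda>n. if n = m then g m else if n < m then g n else f n)"
    by (intro recursive_if[OF decidable_eq[OF recursive_id recursive_const] recursive_const])
  moreover have "(\<lambda>n. if n = m then g m else if n < m then g n else f n)
      = (\<lambda>n. if n < Suc m then g n else f n)"
    by (auto simp: less_Suc_eq)
  ultimately show ?case by simp
qed simp

section \<open>Computability on strings\<close>

definition str_decode :: "nat \<Rightarrow> bool list" where
  "str_decode = inv str_encode"

lemma str_decode_encode [simp]: "str_decode (str_encode \<sigma>) = \<sigma>"
  using bij_str_encode by (simp add: str_decode_def bij_is_inj)

lemma str_encode_decode [simp]: "str_encode (str_decode n) = n"
  using bij_str_encode by (simp add: str_decode_def bij_is_surj surj_f_inv_f)

lemma str_encode_inject [simp]: "str_encode \<sigma> = str_encode \<tau> \<longleftrightarrow> \<sigma> = \<tau>"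
  using bij_str_encode by (simp add: bij_is_inj inj_eq)

text \<open>Only the value is a string. String arguments enter as \<open>str_decode\<close> of a
  number, so a single calculus for functions of one number covers both.\<close>

definition recursive_str :: "(nat \<Rightarrow> bool list) \<Rightarrow> bool" where
  "recursive_str F \<longleftrightarrow> recursive (\<lambda>n. str_encode (F n))"

lemma recursive_str_encode [recs]: "recursive_str F \<Longrightarrow> recursive (\<lambda>n. str_encode (F n))"
  by (simp add: recursive_str_def)

lemma recursive_str_decode [recs]: "recursive f \<Longrightarrow> recursive_str (\<lambda>n. str_decode (f n))"
  by (simp add: recursive_str_def)

lemma recursive_str_const [recs]: "recursive_str (\<lambda>n. \<sigma>)"
  by (simp add: recursive_str_def recs)

lemma recursive_str_comp: "recursive_str F \<Longrightarrow> recursive f \<Longrightarrow> recursive_str (\<lambda>n. F (f n))"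
  unfolding recursive_str_def by (rule recursive_comp)

lemma decidable_str_eq [recs]:
  "recursive_str F \<Longrightarrow> recursive_str G \<Longrightarrow> decidable (\<lambda>n. F n = G n)"
  using decidable_eq[of "\<lambda>n. str_encode (F n)" "\<lambda>n. str_encode (G n)"] by (simp add: recursive_str_def)

lemma semidecidable_ex_str [recs]:
  assumes "semidecidable (\<lambda>x. P (p1 x) (str_decode (p2 x)))"
  shows "semidecidable (\<lambda>n. \<exists>\<sigma>. P n \<sigma>)"
proof -
  have "(\<exists>\<sigma>. P n \<sigma>) \<longleftrightarrow> (\<exists>m. P n (str_decode m))" for n
    by (metis str_decode_encode)
  then show ?thesis using semidecidable_ex[OF assms] by simp
qed

text \<open>With digits 1 and 2 and the least significant digit first, removing the head is
  \<open>(r - 1) div 2\<close>; the code 0 of the empty string is a fixed point of this map.\<close>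

lemma str_encode_drop: "str_encode (drop i \<sigma>) = rec_nat (str_encode \<sigma>) (\<lambda>_ r. (r - 1) div 2) i"
proof (induction i)
  case (Suc i)
  have "str_encode (tl \<tau>) = (str_encode \<tau> - 1) div 2" for \<tau> by (cases \<tau>) auto
  moreover have "drop (Suc i) \<sigma> = tl (drop i \<sigma>)" by (simp add: drop_Suc tl_drop)
  ultimately show ?case using Suc by simp
qed simp

lemma recursive_str_drop [recs]:
  "recursive f \<Longrightarrow> recursive_str F \<Longrightarrow> recursive_str (\<lambda>n. drop (f n) (F n))"
  unfolding recursive_str_def[of "\<lambda>n. drop (f n) (F n)"] str_encode_drop by (intro recs)

lemma str_encode_eq_0_iff [simp]: "str_encode \<sigma> = 0 \<longleftrightarrow> \<sigma> = []"
  by (cases \<sigma>) auto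

lemma recursive_length [recs]:
  assumes "recursive_str F" shows "recursive (\<lambda>n. length (F n))"
proof -
  \<comment> \<open>The length counts the \<open>i\<close> for which something remains after
    dropping \<open>i\<close> digits. The code bounds the length and so serves as a computable
    range.\<close>
  have "length \<sigma> = (\<Sum>i<str_encode \<sigma>. if str_encode (drop i \<sigma>) = 0 then 0 else 1)" for \<sigma>
  proof -
    have "length \<sigma> \<le> str_encode \<sigma>" by (induction \<sigma>) auto
    then have "{..<str_encode \<sigma>} \<inter> {i. i < length \<sigma>} = {..<length \<sigma>}" by auto
    then have "length \<sigma> = (\<Sum>i<str_encode \<sigma>. of_bool (i < length \<sigma>))" by simp
    also have "\<dots> = (\<Sum>i<str_encode \<sigma>. if str_encode (drop i \<sigma>) = 0 then 0 else 1)"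
      by (intro sum.cong) auto
    finally show ?thesis .
  qed
  moreover have "recursive (\<lambda>n. \<Sum>i<str_encode (F n).
      if str_encode (drop i (F n)) = 0 then 0 else 1)"
    by (intro recs assms recursive_str_comp[OF assms])
  ultimately show ?thesis by simp
qed

text \<open>The bound is part of the predicate because \<open>!\<close> is unspecified beyond the
  end. After \<open>i\<close> digits are dropped, the code is 0 at the end and otherwise even
  exactly when the next digit is \<open>True\<close>.\<close>

lemma decidable_nth [recs]:
  assumes "recursive f" "recursive_str F"
  shows "decidable (\<lambda>n. f n < length (F n) \<and> F n ! f n)"
proof -
  have "i < length \<sigma> \<and> \<sigma> ! i \<longleftrightarrow>
      str_encode (drop i \<sigma>) \<noteq> 0 \<and> str_encode (drop i \<sigma>) mod 2 = 0" for i \<sigma>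
  proof (cases "i < length \<sigma>")
    case True
    then show ?thesis by (simp add: Cons_nth_drop_Suc[symmetric])
  qed simp
  then show ?thesis by (simp only:) (intro recs assms)
qed

lemma str_encode_append: "str_encode (\<sigma> @ \<tau>) = str_encode \<sigma> + 2 ^ length \<sigma> * str_encode \<tau>"
  by (induction \<sigma>) (auto simp: algebra_simps)

lemma recursive_str_append [recs]:
  "recursive_str F \<Longrightarrow> recursive_str G \<Longrightarrow> recursive_str (\<lambda>n. F n @ G n)"
  unfolding recursive_str_def[of "\<lambda>n. F n @ G n"] str_encode_append by (intro recs)

lemma recursive_str_take [recs]:
  assumes "recursive f" "recursive_str F" shows "recursive_str (\<lambda>n. take (f n) (F n))"
proof -
  have "str_encode (take i \<sigma>) = str_encode \<sigma> - 2 ^ i * str_encode (drop i \<sigma>)" for i \<sigma>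
  proof (cases "i \<le> length \<sigma>")
    case True
    then have "str_encode \<sigma> = str_encode (take i \<sigma>) + 2 ^ i * str_encode (drop i \<sigma>)"
      using str_encode_append[of "take i \<sigma>" "drop i \<sigma>"] by (simp add: min_def)
    then show ?thesis by linarith
  qed simp
  then show ?thesis
    unfolding recursive_str_def[of "\<lambda>n. take (f n) (F n)"] by (simp only:) (intro recs assms)
qed

text \<open>A prefix-free coding of numbers. It serves for codes behind a fixed string and for
  inputs and outputs of machines that compute functions, where comparability has to mean
  equality.\<close>

definition unary :: "nat \<Rightarrow> bool list" where
  "unary k = replicate k True @ [False]"

lemma prefix_unary_append: "prefix (unary i @ \<rho>) (unary j @ \<sigma>) \<Longrightarrow> i = j"
proof (induction i arbitrary: j)
  case 0
  then show ?case by (cases j) (auto simp: unary_def)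
next
  case (Suc i)
  then show ?case by (cases j) (auto simp: unary_def)
qed

lemma prefix_unary: "prefix (unary i) (unary j) \<longleftrightarrow> i = j"
  using prefix_unary_append[of i "[]" j "[]"] by auto

lemma unary_inject [simp]: "unary i = unary j \<longleftrightarrow> i = j"
  using prefix_unary by (metis prefix_order.order_refl)

lemma recursive_str_unary [recs]:
  assumes "recursive f" shows "recursive_str (\<lambda>n. unary (f n))"
proof -
  \<comment> \<open>The \<open>k\<close> digits 2 contribute \<open>2 * (2 ^ k - 1)\<close> and the
    final digit 1 contributes \<open>2 ^ k\<close>.\<close>
  have "Suc (Suc (str_encode (unary k))) = 3 * 2 ^ k" for k
    by (induction k) (auto simp: unary_def)
  then have "str_encode (unary k) = 3 * 2 ^ k - 2" for k
    by (metis diff_Suc_Suc diff_zero numeral_2_eq_2)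
  then show ?thesis unfolding recursive_str_def by (simp only:) (intro recs assms)
qed

section \<open>Machines\<close>

definition consistent :: "machine \<Rightarrow> bool" where
  "consistent M \<longleftrightarrow> (\<forall>\<rho>\<^sub>1 \<sigma>\<^sub>1 \<rho>\<^sub>2 \<sigma>\<^sub>2. (\<rho>\<^sub>1, \<sigma>\<^sub>1) \<in> M \<longrightarrow> (\<rho>\<^sub>2, \<sigma>\<^sub>2) \<in> M \<longrightarrow>
     prefix \<rho>\<^sub>1 \<rho>\<^sub>2 \<longrightarrow> \<sigma>\<^sub>1 \<sim>\<^sub>s \<sigma>\<^sub>2)"

lemma consistentD:
  "consistent M \<Longrightarrow> (\<rho>\<^sub>1, \<sigma>\<^sub>1) \<in> M \<Longrightarrow> (\<rho>\<^sub>2, \<sigma>\<^sub>2) \<in> M \<Longrightarrow> prefix \<rho>\<^sub>1 \<rho>\<^sub>2 \<Longrightarrow> \<sigma>\<^sub>1 \<sim>\<^sub>s \<sigma>\<^sub>2"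
  unfolding consistent_def by blast

lemma consistent_subset: "consistent M \<Longrightarrow> N \<subseteq> M \<Longrightarrow> consistent N"
  unfolding consistent_def by blast

lemma monotone_machine_iff:
  "monotone_machine M \<longleftrightarrow>
     semidecidable (\<lambda>x. (str_decode (p1 x), str_decode (p2 x)) \<in> M) \<and> consistent M"
proof -
  have "{prod_encode (str_encode \<rho>, str_encode \<sigma>) | \<rho> \<sigma>. (\<rho>, \<sigma>) \<in> M}
      = {x. (str_decode (p1 x), str_decode (p2 x)) \<in> M}" (is "?A = ?B")
  proof (intro equalityI subsetI)
    fix x assume "x \<in> ?B"
    moreover have "x = prod_encode (str_encode (str_decode (p1 x)), str_encode (str_decode (p2 x)))"
      by simp
    ultimately show "x \<in> ?A" by blast
  qed auto
  then show ?thesis by (simp add: monotone_machine_def semidecidable_def consistent_def)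
qed

lemma uniformly_ce_iff:
  "uniformly_ce N \<longleftrightarrow>
     semidecidable (\<lambda>x. (str_decode (p1 (p2 x)), str_decode (p2 (p2 x))) \<in> N (p1 x))"
proof -
  have "{prod_encode (k, prod_encode (str_encode \<rho>, str_encode \<sigma>)) | k \<rho> \<sigma>. (\<rho>, \<sigma>) \<in> N k}
      = {x. (str_decode (p1 (p2 x)), str_decode (p2 (p2 x))) \<in> N (p1 x)}" (is "?A = ?B")
  proof (intro equalityI subsetI)
    fix x assume "x \<in> ?B"
    moreover have "x = prod_encode (p1 x, prod_encode (str_encode (str_decode (p1 (p2 x))),
        str_encode (str_decode (p2 (p2 x)))))"
      by simp
    ultimately show "x \<in> ?A" by blast
  qed auto
  then show ?thesis by (simp add: uniformly_ce_def semidecidable_def)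
qed

lemma semidecidable_mem:
  assumes "uniformly_ce N" "recursive e" "recursive_str F" "recursive_str G"
  shows "semidecidable (\<lambda>n. (F n, G n) \<in> N (e n))"
  using semidecidable_comp[OF assms(1)[unfolded uniformly_ce_iff],
      of "\<lambda>n. prod_encode (e n, prod_encode (str_encode (F n), str_encode (G n)))"]
    assms(2-)
  by (simp add: recs)

lemma uniformly_ce_imp_monotone_machine:
  "uniformly_ce N \<Longrightarrow> consistent (N k) \<Longrightarrow> monotone_machine (N k)"
  unfolding monotone_machine_iff by (intro conjI semidecidable_mem recs)

lemma semidecidable_mem_machine:
  assumes "monotone_machine M" "recursive_str F" "recursive_str G"
  shows "semidecidable (\<lambda>n. (F n, G n) \<in> M)"
  using semidecidable_comp[OF conjunct1[OF assms(1)[unfolded monotone_machine_iff]],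
      of "\<lambda>n. prod_encode (str_encode (F n), str_encode (G n))"]
    assms(2-)
  by (simp add: recs)

lemma machine_enumerationD:
  assumes "machine_enumeration M"
  shows "uniformly_ce M" "monotone_machine (M e)" "consistent (M e)"
    and "monotone_machine N \<Longrightarrow> \<exists>e. N = M e"
    and "uniformly_ce N' \<Longrightarrow> (\<And>k. monotone_machine (N' k)) \<Longrightarrow> \<exists>h. recursive h \<and> (\<forall>k. N' k = M (h k))"
proof -
  have range: "range M = {N. monotone_machine N}"
    using assms by (auto simp: machine_enumeration_def)
  then show "monotone_machine (M e)" by (metis mem_Collect_eq rangeI)
  then show "consistent (M e)" by (simp add: monotone_machine_iff)
  show "monotone_machine N \<Longrightarrow> \<exists>e. N = M e" using range by (metis mem_Collect_eq rangeE)
qed (use assms in \<open>auto simp: machine_enumeration_def\<close>)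

text \<open>
  The diagonal argument for the recursion theorem, with the machine \<open>M x\<close> standing in for the
  \<open>x\<close>-th partial recursive function: it maps \<open>i\<close> to \<open>j\<close> if it contains the pair of \<open>unary i\<close>
  and \<open>unary j\<close>.
\<close>

lemma machine_fixed_point:
  assumes M: "machine_enumeration M" and N: "uniformly_ce N" "\<And>k. monotone_machine (N k)"
  obtains c where "M c = N c"
proof -
  \<comment> \<open>\<open>D x\<close> applies the \<open>x\<close>-th machine to the code of its
    own index and behaves as \<open>N j\<close> if the result is \<open>j\<close>.\<close>
  define D where "D x = {p. \<exists>j. (unary x, unary j) \<in> M x \<and> p \<in> N j}" for x
  have "uniformly_ce D"
    unfolding uniformly_ce_iff D_def mem_Collect_eq
    by (intro recs semidecidable_mem[OF machine_enumerationD(1)[OF M]] semidecidable_mem[OF N(1)])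
  \<comment> \<open>Outputs on the same input are comparable, and comparable unary codes are equal,
    so the self-application has at most one result.\<close>
  have unique: "i = j" if "(unary x, unary i) \<in> M x" "(unary x, unary j) \<in> M x" for x i j
    using consistentD[OF machine_enumerationD(3)[OF M] that] by (auto simp: comparable_def prefix_unary)
  have D: "D x = N j" if "(unary x, unary j) \<in> M x" for x j
    using that unique unfolding D_def by blast
  have "consistent (D x)" for x
  proof (cases "\<exists>j. (unary x, unary j) \<in> M x")
    case True
    then show ?thesis using D N(2) by (metis monotone_machine_iff)
  qed (auto simp: D_def consistent_def)
  then have "monotone_machine (D x)" for x
    by (rule uniformly_ce_imp_monotone_machine[OF \<open>uniformly_ce D\<close>])
  then obtain d where d: "recursive d" "\<And>x. D x = M (d x)"
    using machine_enumerationD(5)[OF M \<open>uniformly_ce D\<close>] by blast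
  \<comment> \<open>The graph of \<open>d\<close> is itself a monotone machine. Applied to its own
    index \<open>x\<close> it gives \<open>d x\<close>, so \<open>D x\<close> is
    \<open>N (d x)\<close> as well as \<open>M (d x)\<close>, and \<open>d x\<close> is the fixed
    point.\<close>
  define G where "G = {(unary x, unary (d x)) | x. True}"
  have "semidecidable (\<lambda>y. \<exists>x. str_decode (p1 y) = unary x \<and> str_decode (p2 y) = unary (d x))"
    by (intro semidecidable_ex decidable_imp_semidecidable recs recursive_comp[OF d(1)])
  moreover have "consistent G"
    by (auto simp: G_def consistent_def comparable_def prefix_unary)
  ultimately have "monotone_machine G"
    by (simp add: monotone_machine_iff G_def)
  then obtain x where "G = M x" using machine_enumerationD(4)[OF M] by blast
  then have "(unary x, unary (d x)) \<in> M x" by (auto simp: G_def)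
  from D[OF this] d(2)[of x] show ?thesis using that by simp
qed

section \<open>Universality by adjunction\<close>

definition adjoin :: "(nat \<Rightarrow> bool list) \<Rightarrow> (nat \<Rightarrow> machine) \<Rightarrow> machine" where
  "adjoin code M = {(code e @ \<rho>, \<sigma>) | e \<rho> \<sigma>. (\<rho>, \<sigma>) \<in> M e}"

lemma encoding_append_prefix:
  assumes "encoding code" "prefix (code d @ \<rho>) (code e @ \<sigma>)"
  shows "d = e"
proof -
  have "prefix (code d) (code e @ \<sigma>)" "prefix (code e) (code e @ \<sigma>)"
    using assms(2) by (auto dest: append_prefixD)
  then have "prefix (code d) (code e) \<or> prefix (code e) (code d)"
    by (rule prefix_same_cases)
  then show ?thesis using assms(1) by (metis encoding_def injD)
qed

lemma mem_adjoin_iff: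
  assumes "encoding code" shows "(code e @ \<rho>, \<sigma>) \<in> adjoin code M \<longleftrightarrow> (\<rho>, \<sigma>) \<in> M e"
proof
  assume "(code e @ \<rho>, \<sigma>) \<in> adjoin code M"
  then obtain d \<rho>' where d: "code e @ \<rho> = code d @ \<rho>'" "(\<rho>', \<sigma>) \<in> M d"
    by (auto simp: adjoin_def)
  with encoding_append_prefix[OF assms, of e \<rho> d \<rho>'] show "(\<rho>, \<sigma>) \<in> M e" by simp
qed (auto simp: adjoin_def)

lemma consistent_adjoin:
  assumes code: "encoding code" and M: "\<And>e. consistent (M e)"
  shows "consistent (adjoin code M)"
  unfolding consistent_def
proof (intro allI impI)
  fix \<rho>\<^sub>1 \<sigma>\<^sub>1 \<rho>\<^sub>2 \<sigma>\<^sub>2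
  assume "(\<rho>\<^sub>1, \<sigma>\<^sub>1) \<in> adjoin code M" "(\<rho>\<^sub>2, \<sigma>\<^sub>2) \<in> adjoin code M" "prefix \<rho>\<^sub>1 \<rho>\<^sub>2"
  then obtain d \<rho> e \<rho>' where *: "\<rho>\<^sub>1 = code d @ \<rho>" "(\<rho>, \<sigma>\<^sub>1) \<in> M d" "\<rho>\<^sub>2 = code e @ \<rho>'" "(\<rho>', \<sigma>\<^sub>2) \<in> M e"
    "prefix (code d @ \<rho>) (code e @ \<rho>')"
    by (auto simp: adjoin_def)
  with encoding_append_prefix[OF code *(5)] show "\<sigma>\<^sub>1 \<sim>\<^sub>s \<sigma>\<^sub>2" using consistentD[OF M] by auto
qed

lemma universal_machine_adjoin:
  assumes code: "encoding code" and M: "machine_enumeration M"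
  shows "universal_machine (adjoin code M)"
proof -
  have rec_code: "recursive_str code"
    using code by (simp add: encoding_def recursive_str_def)
  have "semidecidable (\<lambda>x. \<exists>e \<rho>. str_decode (p1 x) = code e @ \<rho> \<and> (\<rho>, str_decode (p2 x)) \<in> M e)"
    by (intro recs decidable_imp_semidecidable[OF decidable_str_eq] recursive_str_comp[OF rec_code]
        semidecidable_mem[OF machine_enumerationD(1)[OF M]])
  then have "monotone_machine (adjoin code M)"
    using consistent_adjoin[OF code machine_enumerationD(3)[OF M]]
    by (simp add: monotone_machine_iff adjoin_def)
  moreover have "universal_via code M (adjoin code M)"
    unfolding universal_via_def using code M
    by (auto simp: mem_adjoin_iff[OF code]) (auto simp: adjoin_def)
  ultimately show ?thesis by (auto simp: universal_machine_def)
qed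

lemma universal_via_eq_adjoin:
  assumes "universal_via code M U" shows "U = adjoin code M"
proof -
  have mem: "(code e @ \<rho>, \<sigma>) \<in> U \<longleftrightarrow> (\<rho>, \<sigma>) \<in> M e" for e \<rho> \<sigma>
    using assms by (simp add: universal_via_def)
  have "\<exists>e \<rho>. \<tau> = code e @ \<rho>" if "(\<tau>, \<sigma>) \<in> U" for \<tau> \<sigma>
    using assms that by (auto simp: universal_via_def)
  then show ?thesis unfolding adjoin_def using mem by (auto, metis)
qed

text \<open>The new machines already occur among the monotone machines, so the range stays the same,
  and acceptability survives because the translating function is shifted by
  \<open>m\<close>.\<close>

lemma machine_enumeration_prepend:
  assumes M: "machine_enumeration M" and V: "\<And>i. i < m \<Longrightarrow> monotone_machine (V i)"
  shows "machine_enumeration (\<lambda>i. if i < m then V i else M (i - m))" (is "machine_enumeration ?M")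
proof -
  have "semidecidable (\<lambda>x. (\<exists>i<m. p1 x = i \<and> (str_decode (p1 (p2 x)), str_decode (p2 (p2 x))) \<in> V i)
      \<or> (m \<le> p1 x \<and> (str_decode (p1 (p2 x)), str_decode (p2 (p2 x))) \<in> M (p1 x - m)))"
    by (intro semidecidable_disj semidecidable_conj semidecidable_bounded_ex semidecidable_mem_machine[OF V]
        semidecidable_mem[OF machine_enumerationD(1)[OF M]] decidable_imp_semidecidable[OF decidable_le]
        decidable_imp_semidecidable[OF decidable_eq] recs)
  then have "uniformly_ce ?M"
    unfolding uniformly_ce_iff by (rule back_subst[of semidecidable]) auto
  moreover have "range ?M = {N. monotone_machine N}"
  proof (intro equalityI subsetI)
    fix N :: machine assume "N \<in> {N. monotone_machine N}"
    then obtain e where "N = M e" using machine_enumerationD(4)[OF M] by blast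
    then have "N = ?M (e + m)" by simp
    then show "N \<in> range ?M" by blast
  qed (use V machine_enumerationD(2)[OF M] in auto)
  moreover have "\<exists>h. recursive h \<and> (\<forall>k. N k = ?M (h k))"
    if N: "uniformly_ce N" "\<forall>k. monotone_machine (N k)" for N
  proof -
    obtain h where "recursive h" "\<And>k. N k = M (h k)"
      using machine_enumerationD(5)[OF M N(1)] N(2) by blast
    then show ?thesis by (intro exI[of _ "\<lambda>k. h k + m"]) (simp add: recs)
  qed
  ultimately show ?thesis by (auto simp: machine_enumeration_def)
qed

section \<open>Transport of machines between continuous measures\<close>

abbreviation init :: "bool word \<Rightarrow> nat \<Rightarrow> bool list" where
  "init X n \<equiv> map X [0..<n]"

lemma mem_cylinder_iff: "X \<in> cylinder \<sigma> \<longleftrightarrow> init X (length \<sigma>) = \<sigma>"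
proof
  assume "init X (length \<sigma>) = \<sigma>"
  then have "X i = \<sigma> ! i" if "i < length \<sigma>" for i
    using that by (metis add_0 diff_zero length_upt nth_map_upt)
  then have "X = \<sigma> \<frown> (\<lambda>i. X (i + length \<sigma>))"
    by (auto simp: conc_def fun_eq_iff)
  then show "X \<in> cylinder \<sigma>" unfolding cylinder_def by blast
qed (auto simp: cylinder_def intro!: nth_equalityI)

lemma init_mem_cylinder [simp]: "X \<in> cylinder (init X n)"
  by (simp add: mem_cylinder_iff)

lemma cylinder_Nil [simp]: "cylinder [] = UNIV"
  by (auto simp: mem_cylinder_iff)

lemma prefix_init: "m \<le> n \<Longrightarrow> prefix (init X m) (init X n)"
  using map_mono_prefix[of "[0..<m]" "[0..<n]" X]
  by (metis le_add_diff_inverse prefixI upt_add_eq_append zero_le)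

lemma cylinder_antimono: "prefix \<rho> \<sigma> \<Longrightarrow> cylinder \<sigma> \<subseteq> cylinder \<rho>"
  by (auto simp: cylinder_def prefix_def simp flip: conc_conc)

lemma prefix_of_cylinder:
  assumes "X \<in> cylinder \<rho>" "X \<in> cylinder \<sigma>" "length \<rho> \<le> length \<sigma>"
  shows "prefix \<rho> \<sigma>"
  using assms prefix_init[of "length \<rho>" "length \<sigma>" X] by (simp add: mem_cylinder_iff)

lemma cylinder_disjoint: "\<not> \<rho> \<sim>\<^sub>s \<sigma> \<Longrightarrow> cylinder \<rho> \<inter> cylinder \<sigma> = {}"
  using prefix_of_cylinder unfolding comparable_def by (meson disjoint_iff nle_le)

lemma cylinder_snoc: "cylinder \<rho> = cylinder (\<rho> @ [False]) \<union> cylinder (\<rho> @ [True])"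
  by (auto simp: mem_cylinder_iff)

lemma open_cylinder: "open (cylinder \<sigma>)"
proof -
  have "cylinder \<sigma> = (\<Pi>\<^sub>E i\<in>UNIV. if i < length \<sigma> then {\<sigma> ! i} else UNIV)"
  proof (rule set_eqI)
    fix X
    have "X \<in> cylinder \<sigma> \<longleftrightarrow> (\<forall>i<length \<sigma>. X i = \<sigma> ! i)"
      by (subst mem_cylinder_iff, subst list_eq_iff_nth_eq) simp
    then show "X \<in> cylinder \<sigma> \<longleftrightarrow> X \<in> (\<Pi>\<^sub>E i\<in>UNIV. if i < length \<sigma> then {\<sigma> ! i} else UNIV)"
      by (auto simp: PiE_iff)
  qed
  moreover have "finite {i. (if i < length \<sigma> then {\<sigma> ! i} else UNIV) \<noteq> UNIV}"
    by (rule finite_subset[of _ "{..<length \<sigma>}"]) auto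
  ultimately show ?thesis by (auto intro!: open_PiE open_discrete)
qed

lemma comparable_sym: "\<rho> \<sim>\<^sub>s \<sigma> \<longleftrightarrow> \<sigma> \<sim>\<^sub>s \<rho>"
  by (auto simp: comparable_def)

text \<open>
  The endpoints of the interval occupied by \<open>\<rho>\<close> when the cylinders of each length are laid out
  from left to right in lexicographic order, each with length equal to its measure.
\<close>

definition lo :: "bool word measure \<Rightarrow> bool list \<Rightarrow> real" where
  "lo \<mu> \<rho> = (\<Sum>i<length \<rho>. if \<rho> ! i then measure \<mu> (cylinder (take i \<rho> @ [False])) else 0)"

definition hi :: "bool word measure \<Rightarrow> bool list \<Rightarrow> real" where
  "hi \<mu> \<rho> = lo \<mu> \<rho> + measure \<mu> (cylinder \<rho>)"

text \<open>Strict inequalities make the relation semidecidable for computable measures; by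
  continuity the omitted boundary costs no measure.\<close>

definition inside :: "bool word measure \<Rightarrow> bool word measure \<Rightarrow> bool list \<Rightarrow> bool list \<Rightarrow> bool" where
  "inside \<mu> \<nu> \<rho> \<tau> \<longleftrightarrow> lo \<mu> \<rho> < lo \<nu> \<tau> \<and> hi \<nu> \<tau> < hi \<mu> \<rho>"

definition transport :: "bool word measure \<Rightarrow> bool word measure \<Rightarrow> machine \<Rightarrow> machine" where
  "transport \<mu> \<nu> M = {(\<tau>, \<sigma>). \<exists>\<rho>. (\<rho>, \<sigma>) \<in> M \<and> inside \<mu> \<nu> \<rho> \<tau>}"

lemma lo_snoc:
  "lo \<mu> (\<rho> @ [b]) = lo \<mu> \<rho> + (if b then measure \<mu> (cylinder (\<rho> @ [False])) else 0)"
proof -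
  have "(\<Sum>i<length \<rho>. if (\<rho> @ [b]) ! i then measure \<mu> (cylinder (take i (\<rho> @ [b]) @ [False])) else 0)
      = lo \<mu> \<rho>"
    unfolding lo_def by (intro sum.cong) (auto simp: nth_append)
  then show ?thesis by (simp add: lo_def)
qed

lemma lo_nonneg: "0 \<le> lo \<mu> \<rho>"
  by (auto simp: lo_def intro!: sum_nonneg)

lemma lo_le_hi: "lo \<mu> \<rho> \<le> hi \<mu> \<rho>"
  by (simp add: hi_def)

section \<open>The interval layout of a single continuous measure\<close>

locale continuous_prob = prob_space \<mu> for \<mu> :: "bool word measure" +
  assumes sets_eq: "sets \<mu> = sets borel" and null_singleton: "measure \<mu> {X} = 0"
begin

lemma space_eq [simp]: "space \<mu> = UNIV"
  using sets_eq_imp_space_eq[OF sets_eq] by simp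

lemma sets_cylinder [measurable, simp]: "cylinder \<sigma> \<in> sets \<mu>"
  by (simp add: sets_eq open_cylinder)

lemma sets_cylinders [measurable, simp]: "cylinders A \<in> sets \<mu>"
  unfolding cylinders_def by (rule sets.countable_UN'') auto

lemma measure_Int_cylinder_snoc:
  assumes "S \<in> sets \<mu>"
  shows "measure \<mu> (S \<inter> cylinder \<rho>)
    = measure \<mu> (S \<inter> cylinder (\<rho> @ [False])) + measure \<mu> (S \<inter> cylinder (\<rho> @ [True]))"
proof -
  have "cylinder (\<rho> @ [False]) \<inter> cylinder (\<rho> @ [True]) = {}"
    by (rule cylinder_disjoint) (simp add: comparable_def)
  then show ?thesis
    using assms finite_measure_Union[of "S \<inter> cylinder (\<rho> @ [False])" "S \<inter> cylinder (\<rho> @ [True])"]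
    by (subst cylinder_snoc) (auto simp: Int_Un_distrib)
qed

lemma measure_cylinder_snoc:
  "measure \<mu> (cylinder \<rho>) = measure \<mu> (cylinder (\<rho> @ [False])) + measure \<mu> (cylinder (\<rho> @ [True]))"
  using measure_Int_cylinder_snoc[of UNIV \<rho>] sets.top[of \<mu>] by simp

lemma hi_snoc:
  "hi \<mu> (\<rho> @ [b]) = hi \<mu> \<rho> - (if b then 0 else measure \<mu> (cylinder (\<rho> @ [True])))"
  using measure_cylinder_snoc[of \<rho>] by (cases b) (simp_all add: hi_def lo_snoc)

lemma lo_prefix: "prefix \<rho> \<sigma> \<Longrightarrow> lo \<mu> \<rho> \<le> lo \<mu> \<sigma>"
proof (induction \<sigma> rule: rev_induct)
  case (snoc b \<sigma>)
  then show ?case using lo_snoc[of \<mu> \<sigma> b] by (cases "\<rho> = \<sigma> @ [b]") (auto intro: order_trans)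
qed simp

lemma hi_prefix: "prefix \<rho> \<sigma> \<Longrightarrow> hi \<mu> \<sigma> \<le> hi \<mu> \<rho>"
proof (induction \<sigma> rule: rev_induct)
  case (snoc b \<sigma>)
  then show ?case using hi_snoc[of \<sigma> b]
    by (cases "\<rho> = \<sigma> @ [b]") (auto intro: order_trans[rotated])
qed simp

lemma hi_le_1: "hi \<mu> \<rho> \<le> 1"
  using hi_prefix[of "[]" \<rho>] prob_space by (simp add: hi_def lo_def)

text \<open>At the first position where the strings differ, the one continuing with
  \<open>False\<close> lies to the left of the other.\<close>

lemma incomparable_hi_le_lo:
  assumes "\<not> \<rho> \<sim>\<^sub>s \<sigma>" shows "hi \<mu> \<rho> \<le> lo \<mu> \<sigma> \<or> hi \<mu> \<sigma> \<le> lo \<mu> \<rho>"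
proof -
  have *: "hi \<mu> (\<pi> @ False # \<rho>') \<le> lo \<mu> (\<pi> @ True # \<sigma>')" for \<pi> \<rho>' \<sigma>'
  proof -
    have "hi \<mu> (\<pi> @ False # \<rho>') \<le> hi \<mu> (\<pi> @ [False])" by (rule hi_prefix) simp
    also have "\<dots> = lo \<mu> (\<pi> @ [True])" by (simp add: hi_def lo_snoc)
    also have "\<dots> \<le> lo \<mu> (\<pi> @ True # \<sigma>')" by (rule lo_prefix) simp
    finally show ?thesis .
  qed
  have "\<rho> \<parallel> \<sigma>" using assms by (simp add: comparable_def parallel_def)
  from parallel_decomp[OF this] obtain \<pi> b \<rho>' c \<sigma>' where
    "b \<noteq> c" "\<rho> = \<pi> @ b # \<rho>'" "\<sigma> = \<pi> @ c # \<sigma>'" by blast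
  then show ?thesis using * by (cases b) auto
qed

text \<open>Continuity of the measure enters here: the cylinders around \<open>X\<close> decrease to
  the null set \<open>{X}\<close>.\<close>

lemma cylinder_tendsto_0: "(\<lambda>n. measure \<mu> (cylinder (init X n))) \<longlonglongrightarrow> 0"
proof -
  have "(\<Inter>n. cylinder (init X n)) = {X}"
  proof (intro equalityI subsetI)
    fix Y assume "Y \<in> (\<Inter>n. cylinder (init X n))"
    then have "init Y (Suc n) = init X (Suc n)" for n
      by (metis INT_D UNIV_I length_map length_upt diff_zero mem_cylinder_iff)
    then have "last (init Y (Suc n)) = last (init X (Suc n))" for n by (simp only:)
    then have "Y n = X n" for n by simp
    then show "Y \<in> {X}" by (auto simp: fun_eq_iff)
  qed simp
  moreover have "decseq (\<lambda>n. cylinder (init X n))"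
    unfolding decseq_def by (intro allI impI cylinder_antimono prefix_init)
  ultimately show ?thesis
    using finite_Lim_measure_decseq[of "\<lambda>n. cylinder (init X n)"] null_singleton[of X]
    by (simp add: image_subset_iff)
qed

text \<open>A defect that some child always inherits undiminished can be followed along an infinite
  path, where the shrinking cylinders bound it by 0 in the limit.\<close>

lemma bisection:
  assumes step: "\<And>\<rho>. d \<rho> \<le> max (d (\<rho> @ [False])) (d (\<rho> @ [True]))"
    and bound: "\<And>\<rho>. d \<rho> \<le> measure \<mu> (cylinder \<rho>)"
  shows "d [] \<le> 0"
proof -
  \<comment> \<open>\<open>f\<close> goes to the right child if the defect survives there and to the
    left child otherwise; \<open>X\<close> is the resulting path.\<close>
  define f where "f \<rho> = \<rho> @ [d \<rho> \<le> d (\<rho> @ [True])]" for \<rho>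
  define X where "X n = last ((f ^^ Suc n) [])" for n
  have f: "\<rho> @ [last (f \<rho>)] = f \<rho>" for \<rho> by (simp add: f_def)
  have init: "init X n = (f ^^ n) []" for n
    by (induction n) (simp_all add: X_def f)
  have "d [] \<le> d (init X n)" for n
  proof (induction n)
    case (Suc n)
    have "d (init X n) \<le> d (f (init X n))"
      using step[of "init X n"] by (cases "d (init X n) \<le> d (init X n @ [True])") (auto simp: f_def)
    then show ?case using Suc init[of n] init[of "Suc n"] by simp
  qed simp
  then have "d [] \<le> measure \<mu> (cylinder (init X n))" for n
    using bound order_trans by blast
  with cylinder_tendsto_0[of X] show ?thesis
    by (intro LIMSEQ_le_const) auto
qed

text \<open>Bisection applies to the gap between the measure of the set within a cylinder and the
  length to be expected there. This gap vanishes unless the interval of the cylinder reaches across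
  \<open>t\<close>.\<close>

lemma measure_hi_less:
  assumes "0 \<le> t" "t \<le> 1" shows "measure \<mu> (cylinders {\<rho>. hi \<mu> \<rho> < t}) = t"
proof -
  let ?G = "cylinders {\<rho>. hi \<mu> \<rho> < t}"
  \<comment> \<open>\<open>c \<rho>\<close> is the length of the part of the interval of \<rho> to
    the left of \<open>t\<close>; at the root it is \<open>t\<close> itself.\<close>
  define c where "c \<rho> = max 0 (min (measure \<mu> (cylinder \<rho>)) (t - lo \<mu> \<rho>))" for \<rho>
  define d where "d \<rho> = \<bar>measure \<mu> (?G \<inter> cylinder \<rho>) - c \<rho>\<bar>" for \<rho>
  have below: "d \<rho> = 0" if "hi \<mu> \<rho> < t" for \<rho>
  proof -
    have "?G \<inter> cylinder \<rho> = cylinder \<rho>" using that by (auto simp: cylinders_def)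
    then show ?thesis using that by (simp add: d_def c_def hi_def)
  qed
  have above: "d \<rho> = 0" if "t \<le> lo \<mu> \<rho>" for \<rho>
  proof -
    have "X \<notin> cylinder \<rho>" if "X \<in> cylinder \<sigma>" "hi \<mu> \<sigma> < t" for X \<sigma>
    proof
      assume "X \<in> cylinder \<rho>"
      then have "\<sigma> \<sim>\<^sub>s \<rho>" using that(1) cylinder_disjoint by blast
      then have "lo \<mu> \<rho> \<le> hi \<mu> \<sigma>"
        using lo_prefix[of \<rho> \<sigma>] hi_prefix[of \<sigma> \<rho>] lo_le_hi[of \<mu> \<rho>] lo_le_hi[of \<mu> \<sigma>]
        by (auto simp: comparable_def)
      then show False using that(2) \<open>t \<le> lo \<mu> \<rho>\<close> by simp
    qed
    then have "?G \<inter> cylinder \<rho> = {}" by (auto simp: cylinders_def)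
    then show ?thesis using that by (simp add: d_def c_def)
  qed
  have "d [] \<le> 0"
  proof (rule bisection)
    fix \<rho>
    have "max 0 (min (p + q) s) = max 0 (min p s) + max 0 (min q (s - p))"
      if "0 \<le> p" "0 \<le> q" for p q s :: real
      using that by (auto simp: max_def min_def)
    then have "c \<rho> = c (\<rho> @ [False]) + c (\<rho> @ [True])"
      by (simp add: c_def lo_snoc measure_cylinder_snoc[of \<rho>] diff_diff_eq)
    then have "d \<rho> \<le> d (\<rho> @ [False]) + d (\<rho> @ [True])"
      using measure_Int_cylinder_snoc[of ?G \<rho>] by (simp add: d_def)
    \<comment> \<open>The children meet in one point, so either the right one starts at or after
      \<open>t\<close> or the left one ends before \<open>t\<close>. Hence at most one child carries
      a defect.\<close>
    moreover have "d (\<rho> @ [False]) = 0 \<or> d (\<rho> @ [True]) = 0"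
    proof (cases "t \<le> lo \<mu> (\<rho> @ [True])")
      case False
      then have "hi \<mu> (\<rho> @ [False]) < t" by (simp add: hi_def lo_snoc)
      then show ?thesis using below by blast
    qed (use above in blast)
    ultimately show "d \<rho> \<le> max (d (\<rho> @ [False])) (d (\<rho> @ [True]))" by auto
    have "measure \<mu> (?G \<inter> cylinder \<rho>) \<le> measure \<mu> (cylinder \<rho>)"
      by (intro finite_measure_mono) auto
    moreover have "0 \<le> c \<rho>" "c \<rho> \<le> measure \<mu> (cylinder \<rho>)" by (auto simp: c_def)
    ultimately show "d \<rho> \<le> measure \<mu> (cylinder \<rho>)"
      unfolding d_def using measure_nonneg[of \<mu> "?G \<inter> cylinder \<rho>"] by linarith
  qed
  then show ?thesis using assms prob_space by (simp add: d_def c_def lo_def)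
qed

text \<open>For a point of the complement every initial segment starts at or before
  \<open>a\<close>; as the lengths tend to 0, one of these intervals ends before
  \<open>b\<close>.\<close>

lemma Compl_lo_subset_hi:
  assumes "a < b" shows "- cylinders {\<rho>. a < lo \<mu> \<rho>} \<subseteq> cylinders {\<rho>. hi \<mu> \<rho> < b}"
proof
  fix X assume X: "X \<in> - cylinders {\<rho>. a < lo \<mu> \<rho>}"
  have "lo \<mu> (init X n) \<le> a" for n
  proof (rule ccontr)
    assume "\<not> lo \<mu> (init X n) \<le> a"
    then have "X \<in> cylinders {\<rho>. a < lo \<mu> \<rho>}"
      unfolding cylinders_def by (intro UN_I[of "init X n"]) auto
    with X show False by simp
  qed
  moreover have "\<forall>\<^sub>F n in sequentially. measure \<mu> (cylinder (init X n)) < b - a"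
    using assms by (intro order_tendstoD[OF cylinder_tendsto_0]) simp
  then obtain n where "measure \<mu> (cylinder (init X n)) < b - a"
    using eventually_happens'[OF sequentially_bot] by blast
  ultimately have "hi \<mu> (init X n) < b" unfolding hi_def by (smt (verit))
  then show "X \<in> cylinders {\<rho>. hi \<mu> \<rho> < b}"
    unfolding cylinders_def by (intro UN_I[of "init X n"]) auto
qed

lemma sets_Compl_cylinders: "- cylinders A \<in> sets \<mu>"
  using sets.compl_sets[OF sets_cylinders] by (simp add: Compl_eq_Diff_UNIV)

text \<open>The complement is squeezed between the sets given by \<open>hi \<mu> \<rho> < a\<close>
  and \<open>hi \<mu> \<rho> < s\<close> for \<open>s > a\<close>.\<close>

lemma measure_lo_le:
  assumes "0 \<le> a" "a \<le> 1" shows "measure \<mu> (- cylinders {\<rho>. a < lo \<mu> \<rho>}) = a"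
proof -
  let ?C = "- cylinders {\<rho>. a < lo \<mu> \<rho>}"
  have "cylinders {\<rho>. hi \<mu> \<rho> < a} \<subseteq> ?C"
  proof
    fix X assume "X \<in> cylinders {\<rho>. hi \<mu> \<rho> < a}"
    then obtain \<rho> where \<rho>: "X \<in> cylinder \<rho>" "hi \<mu> \<rho> < a" by (auto simp: cylinders_def)
    have "lo \<mu> \<sigma> < a" if "X \<in> cylinder \<sigma>" for \<sigma>
    proof -
      have "\<rho> \<sim>\<^sub>s \<sigma>" using \<rho>(1) that cylinder_disjoint by blast
      then show ?thesis
        using lo_prefix[of \<sigma> \<rho>] hi_prefix[of \<rho> \<sigma>] lo_le_hi[of \<mu> \<rho>] lo_le_hi[of \<mu> \<sigma>] \<rho>(2)
        by (auto simp: comparable_def)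
    qed
    then show "X \<in> ?C" by (fastforce simp: cylinders_def)
  qed
  from finite_measure_mono[OF this sets_Compl_cylinders] have lower: "a \<le> measure \<mu> ?C"
    using measure_hi_less[OF assms] by simp
  have upper: "measure \<mu> ?C \<le> s" if "a < s" "s \<le> 1" for s
  proof -
    have "?C \<subseteq> cylinders {\<rho>. hi \<mu> \<rho> < s}" using that(1) by (rule Compl_lo_subset_hi)
    from finite_measure_mono[OF this] show ?thesis using measure_hi_less[of s] that assms by simp
  qed
  show ?thesis
  \<comment> \<open>At \<open>a = 1\<close> there is no room for \<open>s\<close> in the unit
    interval, and the upper bound comes from the total mass.\<close>
  proof (cases "a = 1")
    case True
    then show ?thesis using lower prob_le_1[of ?C] by linarith
  next
    case False
    then have "measure \<mu> ?C \<le> a" using upper assms by (intro dense_ge_bounded[of a 1]) auto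
    then show ?thesis using lower by simp
  qed
qed

text \<open>If one string around a point satisfies the lower bound and another the upper bound, the
  longer of the two satisfies both. The set is thus a difference of two sets of known
  measure.\<close>

lemma measure_interval:
  assumes "0 \<le> a" "a \<le> b" "b \<le> 1"
  shows "measure \<mu> (cylinders {\<rho>. a < lo \<mu> \<rho> \<and> hi \<mu> \<rho> < b}) = b - a"
proof (cases "a = b")
  case True
  then have "\<not> (a < lo \<mu> \<rho> \<and> hi \<mu> \<rho> < b)" for \<rho> using lo_le_hi[of \<mu> \<rho>] by linarith
  then have "{\<rho>. a < lo \<mu> \<rho> \<and> hi \<mu> \<rho> < b} = {}" by blast
  then have "cylinders {\<rho>. a < lo \<mu> \<rho> \<and> hi \<mu> \<rho> < b} = {}"
    unfolding cylinders_def by (simp only: UN_empty)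
  then show ?thesis using True by simp
next
  case False
  let ?G = "cylinders {\<rho>. hi \<mu> \<rho> < b}" and ?C = "- cylinders {\<rho>. a < lo \<mu> \<rho>}"
  have "X \<in> cylinders {\<rho>. a < lo \<mu> \<rho> \<and> hi \<mu> \<rho> < b} \<longleftrightarrow> X \<in> ?G - ?C" for X
  proof
    assume "X \<in> ?G - ?C"
    then obtain \<rho> \<sigma> where *: "X \<in> cylinder \<rho>" "hi \<mu> \<rho> < b" "X \<in> cylinder \<sigma>" "a < lo \<mu> \<sigma>"
      by (auto simp: cylinders_def)
    then have "\<rho> \<sim>\<^sub>s \<sigma>" using cylinder_disjoint by blast
    then consider "prefix \<rho> \<sigma>" | "prefix \<sigma> \<rho>" by (auto simp: comparable_def)
    then show "X \<in> cylinders {\<rho>. a < lo \<mu> \<rho> \<and> hi \<mu> \<rho> < b}"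
    proof cases
      case 1
      then show ?thesis unfolding cylinders_def using * hi_prefix[OF 1] by (intro UN_I[of \<sigma>]) auto
    next
      case 2
      then show ?thesis unfolding cylinders_def using * lo_prefix[OF 2] by (intro UN_I[of \<rho>]) auto
    qed
  qed (auto simp: cylinders_def)
  then have eq: "cylinders {\<rho>. a < lo \<mu> \<rho> \<and> hi \<mu> \<rho> < b} = ?G - ?C" by blast
  have "?C \<subseteq> ?G" using False assms by (intro Compl_lo_subset_hi) simp
  then have "measure \<mu> (?G - ?C) = measure \<mu> ?G - measure \<mu> ?C"
    using sets_Compl_cylinders by (intro finite_measure_Diff) auto
  then show ?thesis
    using eq measure_hi_less[of b] measure_lo_le[of a] assms by simp
qed

end

section \<open>Comparing the layouts of two measures\<close>

lemma inside_prefix: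
  assumes "continuous_prob \<nu>" "inside \<mu> \<nu> \<rho> \<tau>" "prefix \<tau> \<tau>'"
  shows "inside \<mu> \<nu> \<rho> \<tau>'"
  using assms(2) continuous_prob.lo_prefix[OF assms(1,3)] continuous_prob.hi_prefix[OF assms(1,3)]
  by (simp add: inside_def)

text \<open>Intervals of incomparable strings share at most an endpoint, and strictness excludes
  even a degenerate interval of \<tau> at that point.\<close>

lemma inside_comparable:
  assumes "continuous_prob \<mu>" "inside \<mu> \<nu> \<rho> \<tau>" "inside \<mu> \<nu> \<sigma> \<tau>"
  shows "\<rho> \<sim>\<^sub>s \<sigma>"
  using assms(2,3) continuous_prob.incomparable_hi_le_lo[OF assms(1), of \<rho> \<sigma>] lo_le_hi[of \<nu> \<tau>]
  by (auto simp: inside_def)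

lemma measure_inside:
  assumes \<mu>: "continuous_prob \<mu>" and \<nu>: "continuous_prob \<nu>"
  shows "measure \<nu> (cylinders {\<tau>. inside \<mu> \<nu> \<rho> \<tau>}) = measure \<mu> (cylinder \<rho>)"
  unfolding inside_def
  using continuous_prob.measure_interval[OF \<nu>, of "lo \<mu> \<rho>" "hi \<mu> \<rho>"]
    lo_nonneg lo_le_hi continuous_prob.hi_le_1[OF \<mu>]
  by (simp add: hi_def)

lemma ex_inside:
  assumes "continuous_prob \<mu>" "continuous_prob \<nu>" "0 < measure \<mu> (cylinder \<rho>)"
  shows "\<exists>\<tau>. inside \<mu> \<nu> \<rho> \<tau>"
proof (rule ccontr)
  assume "\<nexists>\<tau>. inside \<mu> \<nu> \<rho> \<tau>"
  then have "cylinders {\<tau>. inside \<mu> \<nu> \<rho> \<tau>} = {}" by (simp add: cylinders_def)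
  then show False using measure_inside[OF assms(1,2), of \<rho>] assms(3) by simp
qed

text \<open>Both sets are disjoint unions over the minimal strings \<open>B\<close> of
  \<open>A\<close>, and each string contributes the same measure to both. Since prefixes have larger
  intervals, restricting to minimal strings loses none of the \<tau>.\<close>

lemma measure_cylinders_inside:
  assumes \<mu>: "continuous_prob \<mu>" and \<nu>: "continuous_prob \<nu>"
  shows "measure \<nu> (cylinders {\<tau>. \<exists>\<rho>\<in>A. inside \<mu> \<nu> \<rho> \<tau>}) = measure \<mu> (cylinders A)"
proof -
  interpret \<mu>: continuous_prob \<mu> by fact
  interpret \<nu>: continuous_prob \<nu> by fact
  define B where "B = {\<rho> \<in> A. \<forall>\<rho>'\<in>A. prefix \<rho>' \<rho> \<longrightarrow> \<rho>' = \<rho>}"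
  have ex_B: "\<exists>\<rho>'\<in>B. prefix \<rho>' \<rho>" if "\<rho> \<in> A" for \<rho>
    using that
  proof (induction "length \<rho>" arbitrary: \<rho> rule: less_induct)
    case less
    show ?case
    proof (cases "\<rho> \<in> B")
      case False
      then obtain \<rho>' where "\<rho>' \<in> A" "strict_prefix \<rho>' \<rho>"
        using less.prems by (auto simp: B_def strict_prefix_def)
      then show ?thesis using less.hyps[of \<rho>'] prefix_length_less
        by (meson prefix_order.less_imp_le prefix_order.trans)
    qed auto
  qed
  have "B \<subseteq> A" by (auto simp: B_def)
  have incomparable: "\<not> \<rho> \<sim>\<^sub>s \<sigma>" if "\<rho> \<in> B" "\<sigma> \<in> B" "\<rho> \<noteq> \<sigma>" for \<rho> \<sigma>
    using that by (auto simp: B_def comparable_def)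
  have "cylinders A = (\<Union>\<rho>\<in>B. cylinder \<rho>)"
    using ex_B cylinder_antimono \<open>B \<subseteq> A\<close> unfolding cylinders_def by blast
  moreover have "disjoint_family_on cylinder B"
    using incomparable cylinder_disjoint by (auto simp: disjoint_family_on_def)
  ultimately have 1: "emeasure \<mu> (cylinders A) = (\<integral>\<^sup>+\<rho>. emeasure \<mu> (cylinder \<rho>) \<partial>count_space B)"
    by (simp add: emeasure_UN_countable)
  let ?I = "\<lambda>\<rho>. cylinders {\<tau>. inside \<mu> \<nu> \<rho> \<tau>}"
  have "inside \<mu> \<nu> \<rho>' \<tau>" if "inside \<mu> \<nu> \<rho> \<tau>" "prefix \<rho>' \<rho>" for \<rho> \<rho>' \<tau>
    using that \<mu>.lo_prefix[OF that(2)] \<mu>.hi_prefix[OF that(2)] by (simp add: inside_def)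
  then have "(\<exists>\<rho>\<in>A. inside \<mu> \<nu> \<rho> \<tau>) \<longleftrightarrow> (\<exists>\<rho>\<in>B. inside \<mu> \<nu> \<rho> \<tau>)" for \<tau>
    using ex_B \<open>B \<subseteq> A\<close> by (meson subsetD)
  then have "cylinders {\<tau>. \<exists>\<rho>\<in>A. inside \<mu> \<nu> \<rho> \<tau>} = (\<Union>\<rho>\<in>B. ?I \<rho>)"
    by (auto simp: cylinders_def)
  moreover have "disjoint_family_on ?I B"
    unfolding disjoint_family_on_def
  proof (intro ballI impI)
    fix \<rho> \<sigma> assume *: "\<rho> \<in> B" "\<sigma> \<in> B" "\<rho> \<noteq> \<sigma>"
    have False if "X \<in> cylinder \<tau>" "inside \<mu> \<nu> \<rho> \<tau>" "X \<in> cylinder \<tau>'" "inside \<mu> \<nu> \<sigma> \<tau>'" for X \<tau> \<tau>'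
    proof -
      have "prefix \<tau> \<tau>' \<or> prefix \<tau>' \<tau>"
        using that(1,3) cylinder_disjoint comparable_def by blast
      then show False
        using that(2,4) inside_prefix[OF \<nu>] inside_comparable[OF \<mu>] incomparable[OF *] by blast
    qed
    then show "?I \<rho> \<inter> ?I \<sigma> = {}" by (auto simp: cylinders_def)
  qed
  ultimately have "emeasure \<nu> (cylinders {\<tau>. \<exists>\<rho>\<in>A. inside \<mu> \<nu> \<rho> \<tau>})
      = (\<integral>\<^sup>+\<rho>. emeasure \<nu> (?I \<rho>) \<partial>count_space B)"
    by (simp add: emeasure_UN_countable)
  also have "\<dots> = emeasure \<mu> (cylinders A)"
    unfolding 1 by (simp add: \<mu>.emeasure_eq_measure \<nu>.emeasure_eq_measure measure_inside[OF \<mu> \<nu>])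
  finally show ?thesis by (simp add: measure_def)
qed

lemma transformation_transport:
  assumes "continuous_prob \<mu>" "continuous_prob \<nu>"
  shows "transformation \<nu> (transport \<mu> \<nu> M) \<sigma> = transformation \<mu> M \<sigma>"
proof -
  have "{\<tau>. \<exists>\<sigma>'. prefix \<sigma> \<sigma>' \<and> (\<tau>, \<sigma>') \<in> transport \<mu> \<nu> M}
      = {\<tau>. \<exists>\<rho>\<in>{\<rho>. \<exists>\<sigma>'. prefix \<sigma> \<sigma>' \<and> (\<rho>, \<sigma>') \<in> M}. inside \<mu> \<nu> \<rho> \<tau>}"
    by (auto simp: transport_def)
  then show ?thesis
    unfolding transformation_def by (simp only: measure_cylinders_inside[OF assms])
qed

text \<open>The interval of the longer input lies inside the intervals of both original inputs,
  which are therefore comparable.\<close>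

lemma consistent_transport:
  assumes "continuous_prob \<mu>" "continuous_prob \<nu>" and M: "consistent M"
  shows "consistent (transport \<mu> \<nu> M)"
  unfolding consistent_def
proof (intro allI impI)
  fix \<tau>\<^sub>1 \<sigma>\<^sub>1 \<tau>\<^sub>2 \<sigma>\<^sub>2
  assume "(\<tau>\<^sub>1, \<sigma>\<^sub>1) \<in> transport \<mu> \<nu> M" "(\<tau>\<^sub>2, \<sigma>\<^sub>2) \<in> transport \<mu> \<nu> M" and "prefix \<tau>\<^sub>1 \<tau>\<^sub>2"
  then obtain \<rho>\<^sub>1 \<rho>\<^sub>2 where \<rho>: "(\<rho>\<^sub>1, \<sigma>\<^sub>1) \<in> M" "inside \<mu> \<nu> \<rho>\<^sub>1 \<tau>\<^sub>1" "(\<rho>\<^sub>2, \<sigma>\<^sub>2) \<in> M" "inside \<mu> \<nu> \<rho>\<^sub>2 \<tau>\<^sub>2"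
    by (auto simp: transport_def)
  then have "\<rho>\<^sub>1 \<sim>\<^sub>s \<rho>\<^sub>2"
    using inside_prefix[OF assms(2) _ \<open>prefix \<tau>\<^sub>1 \<tau>\<^sub>2\<close>] inside_comparable[OF assms(1)] by blast
  then show "\<sigma>\<^sub>1 \<sim>\<^sub>s \<sigma>\<^sub>2"
    using consistentD[OF M] \<rho>(1,3) comparable_sym unfolding comparable_def[of \<rho>\<^sub>1] by blast
qed

lemma transformation_Un:
  assumes "continuous_prob \<mu>"
    and disj: "\<And>\<rho> \<sigma> \<rho>' \<sigma>'. (\<rho>, \<sigma>) \<in> M \<Longrightarrow> (\<rho>', \<sigma>') \<in> N \<Longrightarrow> \<not> \<rho> \<sim>\<^sub>s \<rho>'"
  shows "transformation \<mu> (M \<union> N) \<sigma> = transformation \<mu> M \<sigma> + transformation \<mu> N \<sigma>"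
proof -
  interpret continuous_prob \<mu> by fact
  let ?S = "\<lambda>M. {\<rho>. \<exists>\<sigma>'. prefix \<sigma> \<sigma>' \<and> (\<rho>, \<sigma>') \<in> M}"
  have "?S (M \<union> N) = ?S M \<union> ?S N" by auto
  then have "cylinders (?S (M \<union> N)) = cylinders (?S M) \<union> cylinders (?S N)"
    by (simp add: cylinders_def)
  moreover have "cylinders (?S M) \<inter> cylinders (?S N) = {}"
    using disj cylinder_disjoint by (fastforce simp: cylinders_def)
  ultimately show ?thesis
    unfolding transformation_def by (simp add: finite_measure_Union)
qed

section \<open>Computability of the transport\<close>

text \<open>Fixed-point approximation with \<open>k\<close> binary places and an error, in units of
  the last place, that does not depend on \<open>k\<close>. Such errors simply add up in sums, and
  natural numbers suffice for the nonnegative reals at hand.\<close>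

definition computable_reals :: "(nat \<Rightarrow> real) \<Rightarrow> bool" where
  "computable_reals x \<longleftrightarrow> (\<exists>f e. recursive (\<lambda>y. f (p1 y) (p2 y)) \<and> recursive e \<and>
     (\<forall>n k. \<bar>real (f n k) - 2 ^ k * x n\<bar> \<le> real (e n)))"

lemma semidecidable_less:
  assumes "computable_reals x" "computable_reals y"
  shows "semidecidable (\<lambda>n. x n < y n)"
proof -
  obtain f d where f: "recursive (\<lambda>y. f (p1 y) (p2 y))" "recursive d"
    "\<And>n k. \<bar>real (f n k) - 2 ^ k * x n\<bar> \<le> real (d n)"
    using assms(1) unfolding computable_reals_def by blast
  obtain g e where g: "recursive (\<lambda>y. g (p1 y) (p2 y))" "recursive e"
    "\<And>n k. \<bar>real (g n k) - 2 ^ k * y n\<bar> \<le> real (e n)"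
    using assms(2) unfolding computable_reals_def by blast
  have "x n < y n \<longleftrightarrow> (\<exists>k. f n k + d n + e n < g n k)" for n
  proof
    assume "x n < y n"
    \<comment> \<open>Twice the errors, because the test adds both of them to a comparison in which
      both already occur.\<close>
    obtain k where "2 * (d n + e n) / (y n - x n) < 2 ^ k"
      using real_arch_pow[of 2] by auto
    with \<open>x n < y n\<close> have "2 * (real (d n) + e n) < 2 ^ k * y n - 2 ^ k * x n"
      by (simp add: field_simps)
    then have "real (f n k + d n + e n) < real (g n k)" using f(3)[of n k] g(3)[of n k] by simp
    then show "\<exists>k. f n k + d n + e n < g n k" by (auto simp only: of_nat_less_iff)
  next
    assume "\<exists>k. f n k + d n + e n < g n k"
    then obtain k where "real (f n k + d n + e n) < real (g n k)" by (auto simp only: of_nat_less_iff)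
    then have "2 ^ k * x n < 2 ^ k * y n"
      using f(3)[of n k] g(3)[of n k] unfolding of_nat_add by linarith
    then show "x n < y n" by simp
  qed
  moreover have "decidable (\<lambda>y. f (p1 y) (p2 y) + d (p1 y) + e (p1 y) < g (p1 y) (p2 y))"
    by (intro decidable_less recursive_add f(1) g(1) recursive_comp[OF f(2)] recursive_comp[OF g(2)] recs)
  ultimately show ?thesis by (intro semidecidableI)
qed

text \<open>Both parities share the absolute value \<open>(n + 1) div 2\<close>; the parity
  determines only the sign.\<close>

lemma int_decode_eq_if: "int_decode n = (if even n then int ((n + 1) div 2) else - int ((n + 1) div 2))"
  by (auto simp: int_decode_def sum_decode_def elim!: oddE)

lemma computable_measure_approximation:
  assumes "computable_measure \<mu>"
  obtains A where "recursive (\<lambda>y. A (str_decode (p1 y)) (p2 y))"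
    and "\<And>\<sigma> k. \<bar>real (A \<sigma> k) - 2 ^ k * measure \<mu> (cylinder \<sigma>)\<bar> \<le> 2"
proof -
  obtain g where g: "computable_rat_fun g"
    "\<And>\<sigma> k. \<bar>real_of_rat (g (\<sigma>, k)) - measure \<mu> (cylinder \<sigma>)\<bar> < 1 / 2 ^ k"
    using assms by (auto simp: computable_measure_def)
  obtain f where f: "recursive f"
    "\<And>\<sigma> k. g (\<sigma>, k) = nat_to_rat_surj (f (prod_encode (str_encode \<sigma>, k)))"
    using g(1) by (auto simp: computable_rat_fun_def)
  \<comment> \<open>The floor of \<open>2 ^ k\<close> times the positive part of the rational with
    number \<open>w\<close>: equal parities of the two components mean equal signs. A zero
    denominator gives 0 under natural and under real division.\<close>
  define B where "B w k = (if p1 w mod 2 = p2 w mod 2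
    then ((p1 w + 1) div 2 * 2 ^ k) div ((p2 w + 1) div 2) else 0)" for w k
  have B: "\<bar>real (B w k) - 2 ^ k * max 0 (real_of_rat (nat_to_rat_surj w))\<bar> \<le> 1" for w k
  proof -
    obtain u v where w: "prod_decode w = (u, v)" by (cases "prod_decode w")
    have r: "real_of_rat (nat_to_rat_surj w) = real_of_int (int_decode u) / real_of_int (int_decode v)"
      by (simp add: nat_to_rat_surj_def w Fract_of_int_quotient of_rat_divide)
    let ?P = "(u + 1) div 2" and ?Q = "(v + 1) div 2"
    show ?thesis
    proof (cases "u mod 2 = v mod 2")
      case True
      then have "even u = even v" by presburger
      then have "real_of_rat (nat_to_rat_surj w) = real ?P / real ?Q"
        unfolding r int_decode_eq_if by (cases "even u") (simp_all del: odd_Suc_div_two even_Suc_div_two)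
      then have "2 ^ k * max 0 (real_of_rat (nat_to_rat_surj w)) = real (?P * 2 ^ k) / real ?Q"
        by simp
      moreover have "real (B w k) = of_int \<lfloor>real (?P * 2 ^ k) / real ?Q\<rfloor>"
        using True by (simp only: B_def w fst_conv snd_conv simp_thms if_True floor_divide_of_nat_eq of_int_of_nat_eq)
      ultimately show ?thesis by linarith
    next
      case False
      then have "even u \<noteq> even v" by presburger
      then have "real_of_rat (nat_to_rat_surj w) \<le> 0"
        unfolding r by (cases "even u") (auto simp: int_decode_eq_if divide_nonneg_nonpos divide_nonpos_nonneg)
      then show ?thesis using False by (simp add: B_def w)
    qed
  qed
  let ?A = "\<lambda>\<sigma> k. B (f (prod_encode (str_encode \<sigma>, k))) k"
  show ?thesis
  proof (rule that[of ?A])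
    show "recursive (\<lambda>y. ?A (str_decode (p1 y)) (p2 y))"
      unfolding B_def by (intro recs recursive_comp[OF f(1)])
    fix \<sigma> k
    let ?r = "real_of_rat (g (\<sigma>, k))" and ?m = "measure \<mu> (cylinder \<sigma>)"
    \<comment> \<open>Truncating at 0 cannot move the approximation away from a nonnegative measure.
      The final error 2 is one unit for the approximation and one for the floor.\<close>
    have "\<bar>max 0 ?r - ?m\<bar> < 1 / 2 ^ k"
      using g(2)[of \<sigma> k] measure_nonneg[of \<mu> "cylinder \<sigma>"] by linarith
    then have "2 ^ k * \<bar>max 0 ?r - ?m\<bar> < 1" by (simp add: field_simps)
    then have "\<bar>2 ^ k * (max 0 ?r - ?m)\<bar> < 1" by (simp add: abs_mult)
    then show "\<bar>real (?A \<sigma> k) - 2 ^ k * ?m\<bar> \<le> 2"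
      using B[of "f (prod_encode (str_encode \<sigma>, k))" k] unfolding f(2)[symmetric]
      by (simp add: right_diff_distrib)
  qed
qed

lemma computable_reals_lo_hi:
  assumes "computable_measure \<mu>" "recursive_str F"
  shows "computable_reals (\<lambda>n. lo \<mu> (F n))" "computable_reals (\<lambda>n. hi \<mu> (F n))"
proof -
  obtain A where A: "recursive (\<lambda>y. A (str_decode (p1 y)) (p2 y))"
    "\<And>\<sigma> k. \<bar>real (A \<sigma> k) - 2 ^ k * measure \<mu> (cylinder \<sigma>)\<bar> \<le> 2"
    by (rule computable_measure_approximation[OF assms(1)]) (rule that)
  have rec_A: "recursive (\<lambda>n. A (G n) (k n))" if "recursive_str G" "recursive k" for G k
    using recursive_comp[OF A(1), of "\<lambda>n. prod_encode (str_encode (G n), k n)"] that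
    by (simp add: recs)
  \<comment> \<open>The guard \<open>i < length \<rho>\<close> repeats the range of summation to
    match the form of \<open>decidable_nth\<close>.\<close>
  define L where "L \<rho> k = (\<Sum>i<length \<rho>. if i < length \<rho> \<and> \<rho> ! i then A (take i \<rho> @ [False]) k else 0)"
    for \<rho> k
  have rec_L: "recursive (\<lambda>y. L (F (p1 y)) (p2 y))"
    unfolding L_def by (intro recs rec_A recursive_str_comp[OF assms(2)])
  have L: "\<bar>real (L \<rho> k) - 2 ^ k * lo \<mu> \<rho>\<bar> \<le> real (2 * length \<rho>)" for \<rho> k
  proof -
    let ?m = "\<lambda>i. measure \<mu> (cylinder (take i \<rho> @ [False]))"
    have "real (L \<rho> k) - 2 ^ k * lo \<mu> \<rho>
        = (\<Sum>i<length \<rho>. if \<rho> ! i then real (A (take i \<rho> @ [False]) k) - 2 ^ k * ?m i else 0)"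
      unfolding L_def lo_def of_nat_sum sum_distrib_left sum_subtractf[symmetric]
      by (intro sum.cong) auto
    also have "\<bar>\<dots>\<bar> \<le> (\<Sum>i<length \<rho>. 2)"
      using A(2) by (intro order_trans[OF sum_abs] sum_mono) auto
    finally show ?thesis by simp
  qed
  show "computable_reals (\<lambda>n. lo \<mu> (F n))"
    unfolding computable_reals_def
    by (intro exI[of _ "\<lambda>n. L (F n)"] exI[of _ "\<lambda>n. 2 * length (F n)"] conjI allI L rec_L
        recs assms(2))
  have "\<bar>real (L (F n) k + A (F n) k) - 2 ^ k * hi \<mu> (F n)\<bar> \<le> real (2 * length (F n) + 2)" for n k
    using L[of "F n" k] A(2)[of "F n" k] by (simp add: hi_def distrib_left)
  then show "computable_reals (\<lambda>n. hi \<mu> (F n))"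
    unfolding computable_reals_def
    by (intro exI[of _ "\<lambda>n k. L (F n) k + A (F n) k"] exI[of _ "\<lambda>n. 2 * length (F n) + 2"] conjI allI)
      (auto intro!: recs rec_L rec_A recursive_str_comp[OF assms(2)] assms(2))
qed

lemma semidecidable_inside:
  assumes "computable_measure \<mu>" "computable_measure \<nu>" "recursive_str F" "recursive_str G"
  shows "semidecidable (\<lambda>n. inside \<mu> \<nu> (F n) (G n))"
  unfolding inside_def
  by (intro semidecidable_conj semidecidable_less computable_reals_lo_hi assms)

lemma continuous_probI:
  "computable_measure \<mu> \<Longrightarrow> continuous_measure \<mu> \<Longrightarrow> continuous_prob \<mu>"
  by (simp add: computable_measure_def continuous_measure_def continuous_prob_def
      continuous_prob_axioms_def)

section \<open>Codes avoiding a string, and the universal machine\<close>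

text \<open>The nodes branching off the path to \<open>\<kappa>\<close>; together with
  \<open>\<kappa>\<close> they form a finite maximal prefix-free set.\<close>

definition sibling :: "bool list \<Rightarrow> nat \<Rightarrow> bool list" where
  "sibling \<kappa> i = take i \<kappa> @ [\<not> \<kappa> ! i]"

lemma incomparable_sibling:
  assumes "\<not> \<kappa> \<sim>\<^sub>s \<tau>" shows "\<exists>i<length \<kappa>. \<exists>\<rho>. \<tau> = sibling \<kappa> i @ \<rho>"
proof -
  have "\<kappa> \<parallel> \<tau>" using assms by (simp add: comparable_def parallel_def)
  from parallel_decomp[OF this] obtain \<pi> b \<rho> c \<sigma> where
    "b \<noteq> c" "\<kappa> = \<pi> @ b # \<rho>" "\<tau> = \<pi> @ c # \<sigma>" by blast
  then show ?thesis by (intro exI[of _ "length \<pi>"]) (auto simp: sibling_def)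
qed

lemma not_prefix_sibling:
  assumes "i < length \<kappa>" "i < length \<tau>" "\<tau> ! i = \<kappa> ! i"
  shows "\<not> prefix (sibling \<kappa> i) \<tau>"
proof
  assume "prefix (sibling \<kappa> i) \<tau>"
  then have "\<tau> ! i = sibling \<kappa> i ! i"
    using assms(1) by (auto simp: prefix_def sibling_def nth_append)
  then show False using assms by (simp add: sibling_def nth_append)
qed

lemma encoding_siblings:
  "encoding (\<lambda>i. if i < length \<kappa> then sibling \<kappa> i else \<kappa> @ unary (i - length \<kappa>))"
  (is "encoding ?code")
proof -
  have "recursive (\<lambda>i. if i < length \<kappa> then str_encode (sibling \<kappa> i)
      else str_encode (\<kappa> @ unary (i - length \<kappa>)))"
    by (intro recursive_finite_modification recs)
  then have "recursive (\<lambda>i. str_encode (?code i))" by (simp add: if_distrib)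
  moreover have eq: "i = j" if "prefix (?code i) (?code j)" for i j
  proof (cases "i < length \<kappa>")
    case True
    \<comment> \<open>Every code with a larger index agrees with \<open>\<kappa>\<close> at position
      \<open>i\<close>, where the \<open>i\<close>-th sibling deviates; comparing lengths then
      excludes smaller indices.\<close>
    then have "j \<le> i" using that not_prefix_sibling[OF True, of "?code j"]
      by (cases "j \<le> i") (auto simp: sibling_def nth_append split: if_splits)
    moreover have "length (?code i) \<le> length (?code j)" using that by (rule prefix_length_le)
    then have "i \<le> j" using True \<open>j \<le> i\<close> by (simp add: sibling_def)
    ultimately show ?thesis by simp
  next
    case False
    have "length (?code i) \<le> length (?code j)" using that by (rule prefix_length_le)
    then have "\<not> j < length \<kappa>" using False by (auto simp: sibling_def unary_def)
    then show ?thesis using False that by (simp add: prefix_unary)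
  qed
  moreover have "inj ?code" by (rule injI, rule eq) simp
  moreover have "\<forall>d e. prefix (?code d) (?code e) \<longrightarrow> ?code d = ?code e" by (blast dest: eq)
  ultimately show ?thesis unfolding encoding_def by blast
qed

lemma encoding_append_unary: "encoding (\<lambda>k. \<kappa> @ unary k)"
  unfolding encoding_def inj_def by (auto simp: prefix_unary intro!: recs)

lemma consistent_residual: "consistent M \<Longrightarrow> consistent {(\<rho>, \<sigma>). (\<pi> @ \<rho>, \<sigma>) \<in> M}"
  unfolding consistent_def by auto

theorem theorem2p5:
  fixes \<mu> \<mu>' :: "bool word measure" and U :: machine
  assumes "computable_measure \<mu>" and "continuous_measure \<mu>"
    and "computable_measure \<mu>'" and "continuous_measure \<mu>'"
    and "universal_machine U" and "compatible U \<mu>"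
  shows "\<exists>U'. universal_machine U' \<and> (\<forall>\<sigma>. transformation \<mu> U \<sigma> = transformation \<mu>' U' \<sigma>)"
proof -
  have \<mu>: "continuous_prob \<mu>" and \<mu>': "continuous_prob \<mu>'"
    using assms(1-4) by (auto intro: continuous_probI)
  obtain code M where via: "universal_via code M U" and pos: "\<And>e. 0 < measure \<mu> (cylinder (code e))"
    using assms(6) by (auto simp: compatible_def)
  have code: "encoding code" and M: "machine_enumeration M"
    using via by (auto simp: universal_via_def)
  have rec_code: "recursive_str code"
    using code by (simp add: encoding_def recursive_str_def)
  note rec_code' = recursive_str_comp[OF rec_code]
  note mem_M = semidecidable_mem[OF machine_enumerationD(1)[OF M]]

  \<comment> \<open>Compatibility enters here: a code of positive measure has an interval of
    positive length, so some \<open>\<mu>'\<close>-interval lies in its interior, and a search finds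
    one uniformly in \<open>e\<close>.\<close>
  obtain \<kappa> where rec_\<kappa>: "recursive_str \<kappa>" and \<kappa>: "\<And>e. inside \<mu> \<mu>' (code e) (\<kappa> e)"
  proof -
    have "semidecidable (\<lambda>x. inside \<mu> \<mu>' (code (p1 x)) (str_decode (p2 x)))"
      by (intro semidecidable_inside assms rec_code' recs)
    moreover have "\<exists>m. inside \<mu> \<mu>' (code e) (str_decode m)" for e
      using ex_inside[OF \<mu> \<mu>' pos] by (metis str_decode_encode)
    ultimately obtain f where "recursive f" "\<And>e. inside \<mu> \<mu>' (code e) (str_decode (f e))"
      by (rule recursive_choice) blast
    then show ?thesis using that[of "\<lambda>e. str_decode (f e)"] by (simp add: recs)
  qed
  define L where "L e = adjoin (\<lambda>k. \<kappa> e @ unary k) M" for e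
  have consistent_L: "consistent (L e)" for e
    unfolding L_def by (intro consistent_adjoin encoding_append_unary machine_enumerationD[OF M])

  \<comment> \<open>The machine seen behind \<open>code e\<close> in the transport of
    \<open>L e\<close> back to \<open>\<mu>\<close>. It depends on \<open>e\<close> through both
    \<open>code e\<close> and \<open>\<kappa> e\<close>, hence the need for a fixed point.\<close>
  define N where "N e = {(\<rho>, \<sigma>). (code e @ \<rho>, \<sigma>) \<in> transport \<mu>' \<mu> (L e)}" for e
  have mem_N: "(\<rho>, \<sigma>) \<in> N e \<longleftrightarrow>
      (\<exists>k \<pi>. (\<pi>, \<sigma>) \<in> M k \<and> inside \<mu>' \<mu> ((\<kappa> e @ unary k) @ \<pi>) (code e @ \<rho>))" for \<rho> \<sigma> e
    by (auto simp: N_def transport_def L_def adjoin_def)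
  have "uniformly_ce N"
    unfolding uniformly_ce_iff mem_N
    by (intro semidecidable_ex semidecidable_ex_str semidecidable_conj mem_M semidecidable_inside
        assms rec_code' recursive_str_comp[OF rec_\<kappa>] recs)
  moreover have "consistent (N e)" for e
    unfolding N_def by (intro consistent_residual consistent_transport \<mu> \<mu>' consistent_L)
  \<comment> \<open>At the fixed point the part of \<open>U\<close> behind \<open>code c\<close>
    comes from \<open>L c\<close>, so under \<open>\<mu>'\<close> it can be replaced by
    \<open>L c\<close>, which already holds a copy of every machine.\<close>
  ultimately obtain c where c: "M c = N c"
    using machine_fixed_point[OF M] uniformly_ce_imp_monotone_machine by blast

  define U\<^sub>1 where "U\<^sub>1 = {(code e @ \<rho>, \<sigma>) | e \<rho> \<sigma>. e \<noteq> c \<and> (\<rho>, \<sigma>) \<in> M e}"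
  define U\<^sub>2 where "U\<^sub>2 = {(code c @ \<rho>, \<sigma>) | \<rho> \<sigma>. (\<rho>, \<sigma>) \<in> M c}"
  have U: "U = U\<^sub>1 \<union> U\<^sub>2"
    unfolding universal_via_eq_adjoin[OF via] adjoin_def U\<^sub>1_def U\<^sub>2_def by blast
  have incomparable: "\<not> code e @ \<rho> \<sim>\<^sub>s code c @ \<rho>'" if "e \<noteq> c" for e \<rho> \<rho>'
    using encoding_append_prefix[OF code] that unfolding comparable_def by metis

  \<comment> \<open>Nothing is lost by looking only behind \<open>code c\<close>: every input of
    \<open>L c\<close> extends \<open>\<kappa> c\<close>, whose \<open>\<mu>'\<close>-interval lies
    inside the \<mu>-interval of \<open>code c\<close>, so all transported inputs extend
    \<open>code c\<close>.\<close>
  have U\<^sub>2: "U\<^sub>2 = transport \<mu>' \<mu> (L c)"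
  proof -
    have "prefix (code c) \<tau>" if \<tau>: "(\<tau>, \<sigma>) \<in> transport \<mu>' \<mu> (L c)" for \<tau> \<sigma>
    proof -
      obtain \<pi> where \<pi>: "prefix (\<kappa> c) \<pi>" "inside \<mu>' \<mu> \<pi> \<tau>"
        using \<tau> by (auto simp: transport_def L_def adjoin_def) (metis prefixI)
      then have less: "lo \<mu> (code c) < lo \<mu> \<tau>" "hi \<mu> \<tau> < hi \<mu> (code c)"
        using \<kappa>[of c] continuous_prob.lo_prefix[OF \<mu>' \<pi>(1)] continuous_prob.hi_prefix[OF \<mu>' \<pi>(1)]
        by (auto simp: inside_def)
      then have "code c \<sim>\<^sub>s \<tau>"
        using continuous_prob.incomparable_hi_le_lo[OF \<mu>, of "code c" \<tau>] lo_le_hi[of \<mu> \<tau>] by auto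
      moreover have "\<not> prefix \<tau> (code c)"
        using continuous_prob.lo_prefix[OF \<mu>, of \<tau> "code c"] less by auto
      ultimately show ?thesis by (simp add: comparable_def)
    qed
    then show ?thesis unfolding U\<^sub>2_def c N_def prefix_def by fast
  qed

  define V where "V = transport \<mu> \<mu>' U\<^sub>1"
  have mem_V: "(\<tau>, \<sigma>) \<in> V \<longleftrightarrow>
      (\<exists>e \<rho>. e \<noteq> c \<and> (\<rho>, \<sigma>) \<in> M e \<and> inside \<mu> \<mu>' (code e @ \<rho>) \<tau>)" for \<tau> \<sigma>
    by (auto simp: V_def transport_def U\<^sub>1_def)
  \<comment> \<open>Otherwise the longer of the two strings would have its interval inside those of
    \<open>code c\<close> and of an extension of another code, which are incomparable.\<close>
  have V_incomparable: "\<not> \<kappa> c \<sim>\<^sub>s \<tau>" if V: "(\<tau>, \<sigma>) \<in> V" for \<tau> \<sigma>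
  proof
    assume "\<kappa> c \<sim>\<^sub>s \<tau>"
    obtain e \<rho> where e: "e \<noteq> c" "inside \<mu> \<mu>' (code e @ \<rho>) \<tau>" using V by (auto simp: mem_V)
    obtain \<pi> where "inside \<mu> \<mu>' (code e @ \<rho>) \<pi>" "inside \<mu> \<mu>' (code c) \<pi>"
      using \<open>\<kappa> c \<sim>\<^sub>s \<tau>\<close> e(2) \<kappa>[of c] inside_prefix[OF \<mu>'] unfolding comparable_def by blast
    then show False using inside_comparable[OF \<mu>] incomparable[OF e(1), of \<rho> "[]"] by auto
  qed
  have "consistent U"
    unfolding universal_via_eq_adjoin[OF via]
    by (intro consistent_adjoin code machine_enumerationD(3)[OF M])
  then have "consistent U\<^sub>1" by (rule consistent_subset) (simp add: U)
  then have "consistent V" unfolding V_def by (intro consistent_transport \<mu> \<mu>')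

  let ?m = "length (\<kappa> c)"
  \<comment> \<open>\<open>V\<close> is cut up along the finitely many siblings, and each piece
    becomes a machine in front of the enumeration \<open>M\<close>.\<close>
  define R where "R i = {(\<rho>, \<sigma>). (sibling (\<kappa> c) i @ \<rho>, \<sigma>) \<in> V}" for i
  have "monotone_machine (R i)" for i
    unfolding monotone_machine_iff
  proof
    show "semidecidable (\<lambda>x. (str_decode (p1 x), str_decode (p2 x)) \<in> R i)"
      unfolding R_def mem_Collect_eq case_prod_conv mem_V
      by (intro semidecidable_ex semidecidable_ex_str semidecidable_conj mem_M semidecidable_inside
          assms rec_code' decidable_imp_semidecidable[OF decidable_not] decidable_eq recs)
    show "consistent (R i)" unfolding R_def by (intro consistent_residual \<open>consistent V\<close>)
  qed
  then have enum: "machine_enumeration (\<lambda>i. if i < ?m then R i else M (i - ?m))" (is "machine_enumeration ?M")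
    using machine_enumeration_prepend[OF M] by blast
  let ?code = "\<lambda>i. if i < ?m then sibling (\<kappa> c) i else \<kappa> c @ unary (i - ?m)"
  let ?U' = "adjoin ?code ?M"
  \<comment> \<open>The siblings capture all of \<open>V\<close> because its inputs are incomparable
    with \<open>\<kappa> c\<close>; the remaining codes reproduce \<open>L c\<close> with indices
    shifted by \<open>?m\<close>.\<close>
  have U': "?U' = V \<union> L c"
  proof (intro equalityI subsetI)
    fix x assume "x \<in> ?U'"
    then obtain i \<rho> \<sigma> where "x = (?code i @ \<rho>, \<sigma>)" "(\<rho>, \<sigma>) \<in> ?M i" by (auto simp: adjoin_def)
    then show "x \<in> V \<union> L c" by (cases "i < ?m") (auto simp: R_def L_def adjoin_def)
  next
    fix x assume "x \<in> V \<union> L c"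
    then show "x \<in> ?U'"
    proof
      assume "x \<in> V"
      then obtain \<tau> \<sigma> where x: "x = (\<tau>, \<sigma>)" "(\<tau>, \<sigma>) \<in> V" by (cases x) auto
      obtain i \<rho> where i: "i < ?m" "\<tau> = sibling (\<kappa> c) i @ \<rho>"
        using incomparable_sibling[OF V_incomparable[OF x(2)]] by blast
      then have "(\<rho>, \<sigma>) \<in> ?M i" "\<tau> = ?code i @ \<rho>" using x by (simp_all add: R_def)
      then show ?thesis unfolding adjoin_def x(1) by blast
    next
      assume "x \<in> L c"
      then obtain k \<rho> \<sigma> where "x = ((\<kappa> c @ unary k) @ \<rho>, \<sigma>)" "(\<rho>, \<sigma>) \<in> M k"
        by (auto simp: L_def adjoin_def)
      then have "x = (?code (k + ?m) @ \<rho>, \<sigma>)" "(\<rho>, \<sigma>) \<in> ?M (k + ?m)" by simp_all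
      then show ?thesis unfolding adjoin_def by blast
    qed
  qed
  have "transformation \<mu> U \<sigma> = transformation \<mu>' ?U' \<sigma>" for \<sigma>
  proof -
    have "transformation \<mu> U \<sigma> = transformation \<mu> U\<^sub>1 \<sigma> + transformation \<mu> U\<^sub>2 \<sigma>"
      unfolding U using incomparable by (intro transformation_Un \<mu>) (auto simp: U\<^sub>1_def U\<^sub>2_def)
    \<comment> \<open>The transports run in opposite directions: \<open>V\<close> is carried from
      \<mu> to \<open>\<mu>'\<close>, while \<open>U\<^sub>2\<close> is carried from
      \<open>\<mu>'\<close> to \<mu>.\<close>
    also have "\<dots> = transformation \<mu>' V \<sigma> + transformation \<mu>' (L c) \<sigma>"
      unfolding U\<^sub>2 V_def by (simp add: transformation_transport \<mu> \<mu>')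
    also have "\<dots> = transformation \<mu>' ?U' \<sigma>"
      unfolding U'
    proof (rule transformation_Un[OF \<mu>', symmetric])
      fix \<rho> \<sigma> \<rho>' \<sigma>' assume V: "(\<rho>, \<sigma>) \<in> V" and "(\<rho>', \<sigma>') \<in> L c"
      then have "prefix (\<kappa> c) \<rho>'" by (auto simp: L_def adjoin_def)
      then show "\<not> \<rho> \<sim>\<^sub>s \<rho>'"
        using V_incomparable[OF V] prefix_same_cases prefix_order.trans unfolding comparable_def by metis
    qed
    finally show ?thesis .
  qed
  then show ?thesis
    using universal_machine_adjoin[OF encoding_siblings[of "\<kappa> c"] enum] by blast
qed

end
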